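(* Assume (H1), (H2), (H3), (H4). Let $w\in H^{-1}(\Omega)$ and let $u\in H_0^1(\Omega)$ satisfy $$\int_\Omega j_\xi(x,u,\nabla u)\cdot\nabla z+\int_\Omega j_s(x,u,\nabla u)z=\langle w,z\rangle\qquad\forall z\in V_u,$$ with $j_\xi(x,u,\nabla u)\cdot\nabla u\in L^1(\Omega)$. If $v\in H_0^1(\Omega)$ and $\eta\in L^1(\Omega)$ satisfy $j_s(x,u,\nabla u)v\ge\eta$ and $j_\xi(x,u,\nabla u)\cdot\nabla v\ge\eta$ a.e., then $j_s(x,u,\nabla u)v\in L^1(\Omega)$, $j_\xi(x,u,\nabla u)\cdot\nabla v\in L^1(\Omega)$ and $\int_\Omega j_\xi(x,u,\nabla u)\cdot\nabla v+\int_\Omega j_s(x,u,\nabla u)v=\langle w,v\rangle$. In particular $j_s(x,u,\nabla u)u\in L^1(\Omega)$, $j_s(x,u,\nabla u)\in L^1(\Omega)$, $\int_\Omega j_\xi(x,u,\nabla u)\cdot\nabla u+\int_\Omega j_s(x,u,\nabla u)u=\langle w,u\rangle$, and $u$ is a generalized solution of $-\operatorname{div}(j_\xi(x,u,\nabla u))+j_s(x,u,\nabla u)=w$ in $\Omega$, $u=0$ on $\partial\Omega$.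
   Context: $\Omega\subset\mathbb{R}^N$ bounded open, $N\ge3$. $j$ measurable in $x$, $C^1$ in $(s,\xi)$, partial derivatives $j_s,j_\xi$. (H1) $\xi\mapsto j(x,s,\xi)$ strictly convex; (H2) $\alpha_0|\xi|^2\le j(x,s,\xi)\le\alpha(|s|)|\xi|^2$ ($\alpha_0>0$, $\alpha$ positive increasing continuous); (H3) $|j_s(x,s,\xi)|\le\beta(|s|)|\xi|^2$ ($\beta$ positive increasing continuous); (H4) there is $R>0$ with $j_s(x,s,\xi)s\ge0$ for $|s|\ge R$. $V_u=\{z\in H_0^1\cap L^\infty: u\in L^\infty(\{z\ne0\})\}$. $W_u=\{v\in H_0^1(\Omega): j_\xi(x,u,\nabla u)\cdot\nabla v\in L^1,\ j_s(x,u,\nabla u)v\in L^1\}$. For $\Lambda\in H^{-1}(\Omega)$, $u$ is a generalized solution of $-\operatorname{div}(j_\xi(x,u,\nabla u))+j_s(x,u,\nabla u)=\Lambda$, $u=0$ on $\partial\Omega$, if $u\in H_0^1$, $j_\xi(x,u,\nabla u)\cdot\nabla u\in L^1$, $j_s(x,u,\nabla u)u\in L^1$ and $\int_\Omega j_\xi(x,u,\nabla u)\cdot\nabla v+\int_\Omega j_s(x,u,\nabla u)v=\langle\Lambda,v\rangle$ for all $v\in W_u$. *)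

theory Defs
  imports "HOL-Analysis.Analysis"
begin

definition strict_convex_on :: "'a::real_vector set \<Rightarrow> ('a \<Rightarrow> real) \<Rightarrow> bool" where
  "strict_convex_on S f \<longleftrightarrow>
     (\<forall>x\<in>S. \<forall>y\<in>S. x \<noteq> y \<longrightarrow> (\<forall>t::real. 0 < t \<and> t < 1 \<longrightarrow>
        f ((1 - t) *\<^sub>R x + t *\<^sub>R y) < (1 - t) * f x + t * f y))"

fun iter_deriv :: "'a::euclidean_space list \<Rightarrow> ('a \<Rightarrow> real) \<Rightarrow> ('a \<Rightarrow> real)" where
  "iter_deriv [] f = f"
| "iter_deriv (d # ds) f = (\<lambda>x. frechet_derivative (iter_deriv ds f) (at x) d)"

definition smooth :: "('a::euclidean_space \<Rightarrow> real) \<Rightarrow> bool" where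
  "smooth f \<longleftrightarrow> (\<forall>ds x. iter_deriv ds f differentiable (at x))"

definition grad :: "('a::euclidean_space \<Rightarrow> real) \<Rightarrow> 'a \<Rightarrow> 'a" where
  "grad f x = (\<Sum>i\<in>Basis. frechet_derivative f (at x) i *\<^sub>R i)"

definition test_fun :: "'a::euclidean_space set \<Rightarrow> ('a \<Rightarrow> real) \<Rightarrow> bool" where
  "test_fun \<Omega> \<phi> \<longleftrightarrow> smooth \<phi> \<and> compact (closure {x. \<phi> x \<noteq> 0})
      \<and> closure {x. \<phi> x \<noteq> 0} \<subseteq> \<Omega>"

definition L2 :: "'a::euclidean_space set \<Rightarrow> ('a \<Rightarrow> real) \<Rightarrow> bool" where
  "L2 \<Omega> f \<longleftrightarrow> f \<in> borel_measurable (lebesgue_on \<Omega>)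
      \<and> integrable (lebesgue_on \<Omega>) (\<lambda>x. (f x)\<^sup>2)"

definition L2v :: "'a::euclidean_space set \<Rightarrow> ('a \<Rightarrow> 'a) \<Rightarrow> bool" where
  "L2v \<Omega> g \<longleftrightarrow> g \<in> borel_measurable (lebesgue_on \<Omega>)
      \<and> integrable (lebesgue_on \<Omega>) (\<lambda>x. (norm (g x))\<^sup>2)"

(* u \<in> H_0^1(\<Omega>) with weak gradient Du: H^1-limit of C_c^\<infinity>(\<Omega>) functions *)
definition H01 :: "'a::euclidean_space set \<Rightarrow> ('a \<Rightarrow> real) \<Rightarrow> ('a \<Rightarrow> 'a) \<Rightarrow> bool" where
  "H01 \<Omega> u Du \<longleftrightarrow> L2 \<Omega> u \<and> L2v \<Omega> Du \<and>
     (\<exists>\<phi>. (\<forall>k. test_fun \<Omega> (\<phi> k))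
        \<and> (\<lambda>k. LINT x|lebesgue_on \<Omega>. (\<phi> k x - u x)\<^sup>2) \<longlonglongrightarrow> 0
        \<and> (\<lambda>k. LINT x|lebesgue_on \<Omega>. (norm (grad (\<phi> k) x - Du x))\<^sup>2) \<longlonglongrightarrow> 0)"

definition Hminus1 :: "'a::euclidean_space set \<Rightarrow> (('a \<Rightarrow> real) \<Rightarrow> real) \<Rightarrow> bool" where
  "Hminus1 \<Omega> \<Lambda> \<longleftrightarrow>
     (\<forall>z1 Dz1 z2 Dz2 a b. H01 \<Omega> z1 Dz1 \<longrightarrow> H01 \<Omega> z2 Dz2 \<longrightarrow>
        \<Lambda> (\<lambda>x. a * z1 x + b * z2 x) = a * \<Lambda> z1 + b * \<Lambda> z2)
   \<and> (\<exists>C. \<forall>z Dz. H01 \<Omega> z Dz \<longrightarrow>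
        \<bar>\<Lambda> z\<bar> \<le> C * sqrt (LINT x|lebesgue_on \<Omega>. (norm (Dz x))\<^sup>2))"

definition ess_bdd_on :: "'a::euclidean_space set \<Rightarrow> ('a \<Rightarrow> real) \<Rightarrow> bool" where
  "ess_bdd_on A f \<longleftrightarrow> (\<exists>M. AE x in lebesgue_on A. \<bar>f x\<bar> \<le> M)"

definition in_Vu :: "'a::euclidean_space set \<Rightarrow> ('a \<Rightarrow> real) \<Rightarrow> ('a \<Rightarrow> real) \<Rightarrow> ('a \<Rightarrow> 'a) \<Rightarrow> bool" where
  "in_Vu \<Omega> u z Dz \<longleftrightarrow> H01 \<Omega> z Dz \<and> ess_bdd_on \<Omega> z \<and> ess_bdd_on {x\<in>\<Omega>. z x \<noteq> 0} u"

definition in_Wu :: "'a::euclidean_space set \<Rightarrow> ('a \<Rightarrow> real \<Rightarrow> 'a \<Rightarrow> real) \<Rightarrow> ('a \<Rightarrow> real \<Rightarrow> 'a \<Rightarrow> 'a)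
     \<Rightarrow> ('a \<Rightarrow> real) \<Rightarrow> ('a \<Rightarrow> 'a) \<Rightarrow> ('a \<Rightarrow> real) \<Rightarrow> ('a \<Rightarrow> 'a) \<Rightarrow> bool" where
  "in_Wu \<Omega> js jxi u Du v Dv \<longleftrightarrow> H01 \<Omega> v Dv
     \<and> integrable (lebesgue_on \<Omega>) (\<lambda>x. jxi x (u x) (Du x) \<bullet> Dv x)
     \<and> integrable (lebesgue_on \<Omega>) (\<lambda>x. js x (u x) (Du x) * v x)"

(* generalized solution of -div(j_xi(x,u,Du)) + j_s(x,u,Du) = \<Lambda>, u = 0 on boundary *)
definition gen_solution :: "'a::euclidean_space set \<Rightarrow> ('a \<Rightarrow> real \<Rightarrow> 'a \<Rightarrow> real) \<Rightarrow> ('a \<Rightarrow> real \<Rightarrow> 'a \<Rightarrow> 'a)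
     \<Rightarrow> (('a \<Rightarrow> real) \<Rightarrow> real) \<Rightarrow> ('a \<Rightarrow> real) \<Rightarrow> ('a \<Rightarrow> 'a) \<Rightarrow> bool" where
  "gen_solution \<Omega> js jxi \<Lambda> u Du \<longleftrightarrow> H01 \<Omega> u Du
     \<and> integrable (lebesgue_on \<Omega>) (\<lambda>x. jxi x (u x) (Du x) \<bullet> Du x)
     \<and> integrable (lebesgue_on \<Omega>) (\<lambda>x. js x (u x) (Du x) * u x)
     \<and> (\<forall>v Dv. in_Wu \<Omega> js jxi u Du v Dv \<longrightarrow>
          (LINT x|lebesgue_on \<Omega>. jxi x (u x) (Du x) \<bullet> Dv x)
        + (LINT x|lebesgue_on \<Omega>. js x (u x) (Du x) * v x) = \<Lambda> v)"

end

theory Submission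
  imports Defs
begin

text \<open>The equation is tested with \<open>z\<^sub>n = H\<^sub>n(u) T\<^sub>n(v)\<close>, where the compactly supported \<open>C\<^sup>1\<close> cutoffs \<open>H\<^sub>n\<close>
  increase to \<open>1\<close> and the \<open>T\<^sub>n\<close> are bounded increasing contractions that tend to the identity, so
  \<open>z\<^sub>n\<close> lies in \<open>V\<^sub>u\<close> and tends to \<open>v\<close> in \<open>H\<^sub>0\<^sup>1\<close>. The term with \<open>H\<^sub>n'(u) T\<^sub>n(v)\<close> vanishes in the limit because
  \<open>j\<^sub>\<xi>(x,u,\<nabla>u) \<cdot> \<nabla>u\<close> is integrable. The remaining terms are, up to factors in \<open>[0,1]\<close>, the two integrands
  of the claim, bounded below by \<open>-\<bar>\<eta>\<bar>\<close>: Fatou's lemma shows that the integrands are integrable, and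
  then dominated convergence gives the equation for \<open>v\<close>. For \<open>v = u\<close> a lower bound
  is \<open>\<eta> = -R \<beta>(R) \<bar>\<nabla>u\<bar>\<^sup>2\<close>, and for \<open>v\<close> in \<open>W\<^sub>u\<close> the minimum of the two integrands.\<close>

subsection \<open>Smooth functions and test functions\<close>

lemma has_derivative_grad:
  assumes "f differentiable (at x)"
  shows "(f has_derivative (\<lambda>h. grad f x \<bullet> h)) (at x)"
proof -
  have d: "(f has_derivative frechet_derivative f (at x)) (at x)"
    using assms frechet_derivative_works by blast
  have "frechet_derivative f (at x) h = grad f x \<bullet> h" for h
  proof -
    have lin: "linear (frechet_derivative f (at x))"
      using d has_derivative_linear by blast
    have "frechet_derivative f (at x) h
        = frechet_derivative f (at x) (\<Sum>i\<in>Basis. (h \<bullet> i) *\<^sub>R i)"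
      by (simp add: euclidean_representation)
    also have "\<dots> = (\<Sum>i\<in>Basis. (h \<bullet> i) * frechet_derivative f (at x) i)"
      by (simp add: linear_sum[OF lin] linear_scale[OF lin])
    also have "\<dots> = grad f x \<bullet> h"
      by (simp add: grad_def inner_sum_left inner_commute[of h] mult.commute)
    finally show ?thesis .
  qed
  then have "frechet_derivative f (at x) = (\<lambda>h. grad f x \<bullet> h)" by blast
  with d show ?thesis by simp
qed

lemma grad_eqI:
  assumes "(f has_derivative (\<lambda>h. g \<bullet> h)) (at x)"
  shows "grad f x = g"
proof -
  have "frechet_derivative f (at x) = (\<lambda>h. g \<bullet> h)"
    using assms frechet_derivative_at by metis
  then show ?thesis
    by (simp add: grad_def euclidean_representation)
qed

section \<open>Iterated derivatives and closure properties of smooth functions\<close>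

lemma iter_deriv_append: "iter_deriv (ds @ es) f = iter_deriv ds (iter_deriv es f)"
  by (induction ds) auto

lemma smooth_differentiable: "smooth f \<Longrightarrow> f differentiable (at x)"
  unfolding smooth_def by (metis iter_deriv.simps(1))

lemma smooth_frechet_derivative:
  assumes "smooth f"
  shows "smooth (\<lambda>x. frechet_derivative f (at x) d)"
  unfolding smooth_def
proof (intro allI)
  fix ds x
  have "iter_deriv ds (\<lambda>x. frechet_derivative f (at x) d) = iter_deriv (ds @ [d]) f"
    by (simp add: iter_deriv_append)
  then show "iter_deriv ds (\<lambda>x. frechet_derivative f (at x) d) differentiable at x"
    using assms unfolding smooth_def by metis
qed

text \<open>The algebra generated by the smooth functions is closed under partial derivatives, hence it
  consists of smooth functions; this avoids a Leibniz formula for iterated derivatives.\<close>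

inductive smooth_alg :: "('a::euclidean_space \<Rightarrow> real) \<Rightarrow> bool" where
  base: "smooth f \<Longrightarrow> smooth_alg f"
| const: "smooth_alg (\<lambda>_. c)"
| add: "smooth_alg f \<Longrightarrow> smooth_alg g \<Longrightarrow> smooth_alg (\<lambda>x. f x + g x)"
| mult: "smooth_alg f \<Longrightarrow> smooth_alg g \<Longrightarrow> smooth_alg (\<lambda>x. f x * g x)"

text \<open>Both conclusions go through one induction: the product rule needs differentiability of
  the factors, and it expresses the derivative of a product as a sum of products of members.\<close>

lemma smooth_alg_derivative:
  assumes "smooth_alg f"
  shows "(\<forall>x. f differentiable (at x)) \<and> (\<forall>d. smooth_alg (\<lambda>x. frechet_derivative f (at x) d))"
  using assms
proof induction
  case (base f)
  then show ?case
    by (auto intro: smooth_alg.base smooth_differentiable smooth_frechet_derivative)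
next
  case (const c)
  then show ?case by (auto intro: smooth_alg.const)
next
  case (add f g)
  have "((\<lambda>x. f x + g x) has_derivative
      (\<lambda>h. frechet_derivative f (at x) h + frechet_derivative g (at x) h)) (at x)" for x
    using add by (intro has_derivative_add) (simp_all add: frechet_derivative_works[symmetric])
  then have "frechet_derivative (\<lambda>x. f x + g x) (at x)
      = (\<lambda>h. frechet_derivative f (at x) h + frechet_derivative g (at x) h)" for x
    by (rule frechet_derivative_at[symmetric])
  then show ?case using add by (auto intro: smooth_alg.add)
next
  case (mult f g)
  have "((\<lambda>x. f x * g x) has_derivative
      (\<lambda>h. f x * frechet_derivative g (at x) h + frechet_derivative f (at x) h * g x)) (at x)" for x
    using mult by (intro has_derivative_mult) (simp_all add: frechet_derivative_works[symmetric])
  then have "frechet_derivative (\<lambda>x. f x * g x) (at x)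
      = (\<lambda>h. f x * frechet_derivative g (at x) h + frechet_derivative f (at x) h * g x)" for x
    by (rule frechet_derivative_at[symmetric])
  then show ?case using mult by (auto intro!: smooth_alg.add[OF smooth_alg.mult smooth_alg.mult])
qed

text \<open>The algebra is stable under \<open>iter_deriv\<close>, by induction on the list of
  directions, and all its members are differentiable.\<close>

lemma smooth_alg_imp_smooth:
  assumes "smooth_alg f"
  shows "smooth f"
proof -
  have "smooth_alg (iter_deriv ds f)" for ds
    by (induction ds) (use assms smooth_alg_derivative in auto)
  then show ?thesis
    unfolding smooth_def using smooth_alg_derivative by blast
qed

lemma smooth_const: "smooth (\<lambda>_. c)"
  by (rule smooth_alg_imp_smooth[OF smooth_alg.const])

lemma smooth_add: "smooth f \<Longrightarrow> smooth g \<Longrightarrow> smooth (\<lambda>x. f x + g x)"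
  by (rule smooth_alg_imp_smooth[OF smooth_alg.add[OF smooth_alg.base smooth_alg.base]])

lemma smooth_mult: "smooth f \<Longrightarrow> smooth g \<Longrightarrow> smooth (\<lambda>x. f x * g x)"
  by (rule smooth_alg_imp_smooth[OF smooth_alg.mult[OF smooth_alg.base smooth_alg.base]])

lemma smooth_real_polynomial:
  assumes "real_polynomial_function p" "smooth f"
  shows "smooth (\<lambda>x. p (f x))"
  using assms
proof induction
  case (linear l)
  \<comment> \<open>A linear map on the reals is multiplication by its value at 1.\<close>
  then have "l t = l 1 * t" for t
    using linear_simps(5)[OF linear(1), of t 1] by simp
  then have "(\<lambda>x. l (f x)) = (\<lambda>x. l 1 * f x)" by blast
  then show ?case using linear by (simp add: smooth_mult smooth_const)
qed (auto intro: smooth_const smooth_add smooth_mult)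

lemma continuous_on_smooth: "smooth f \<Longrightarrow> continuous_on S f"
  by (meson continuous_at_imp_continuous_on differentiable_imp_continuous_within smooth_differentiable)

lemma continuous_on_grad: "smooth f \<Longrightarrow> continuous_on S (grad f)"
  unfolding grad_def
  by (intro continuous_intros continuous_on_smooth smooth_frechet_derivative)

section \<open>Support and boundedness of test functions\<close>

lemma test_fun_smooth: "test_fun \<Omega> f \<Longrightarrow> smooth f"
  by (simp add: test_fun_def)

lemma grad_eq_0_outside_support:
  assumes "x \<notin> closure {x. f x \<noteq> 0}"
  shows "grad f x = 0"
proof (rule grad_eqI)
  have "((\<lambda>_. 0) has_derivative (\<lambda>h. 0 \<bullet> h)) (at x)" by simp
  then show "(f has_derivative (\<lambda>h. 0 \<bullet> h)) (at x)"
  proof (rule has_derivative_transform_within_open)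
    show "open (- closure {x. f x \<noteq> 0})" by auto
    show "x \<in> - closure {x. f x \<noteq> 0}" using assms by auto
    show "0 = f y" if "y \<in> - closure {x. f x \<noteq> 0}" for y
      using that closure_subset[of "{x. f x \<noteq> 0}"] by auto
  qed
qed

lemma bounded_of_compact_support:
  fixes f :: "'a::euclidean_space \<Rightarrow> 'b::real_normed_vector"
  assumes "continuous_on UNIV f" "compact K" "\<And>x. x \<notin> K \<Longrightarrow> f x = 0"
  obtains B where "B \<ge> 0" "\<And>x. norm (f x) \<le> B"
proof -
  have "compact (f ` K)"
    using assms by (meson compact_continuous_image continuous_on_subset subset_UNIV)
  then obtain B where "\<And>y. y \<in> f ` K \<Longrightarrow> norm y \<le> B"
    using compact_imp_bounded bounded_iff by metis
  then have "norm (f x) \<le> \<bar>B\<bar>" for x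
    by (cases "x \<in> K") (use assms(3) in force)+
  then show thesis using that[of "\<bar>B\<bar>"] by auto
qed

lemma test_fun_bounded:
  assumes "test_fun \<Omega> f"
  obtains B where "B \<ge> 0" "\<And>x. \<bar>f x\<bar> \<le> B"
proof (rule bounded_of_compact_support[of f "closure {x. f x \<noteq> 0}"])
  show "f x = 0" if "x \<notin> closure {x. f x \<noteq> 0}" for x
    using that closure_subset[of "{x. f x \<noteq> 0}"] by auto
qed (use assms that in \<open>auto simp: test_fun_def continuous_on_smooth\<close>)

lemma test_fun_grad_bounded:
  assumes "test_fun \<Omega> f"
  obtains B where "B \<ge> 0" "\<And>x. norm (grad f x) \<le> B"
  by (rule bounded_of_compact_support[of "grad f" "closure {x. f x \<noteq> 0}"])
     (use assms that in \<open>auto simp: test_fun_def continuous_on_grad grad_eq_0_outside_support\<close>)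

lemma test_fun_support_mono:
  assumes "test_fun \<Omega> f" "smooth g" "\<And>x. f x = 0 \<Longrightarrow> g x = 0"
  shows "test_fun \<Omega> g"
proof -
  have "closure {x. g x \<noteq> 0} \<subseteq> closure {x. f x \<noteq> 0}"
    by (rule closure_mono) (use assms(3) in auto)
  then show ?thesis
    using assms unfolding test_fun_def
    by (metis bounded_subset closed_closure compact_eq_bounded_closed subset_trans)
qed

lemma test_fun_lincomb:
  assumes "test_fun \<Omega> f" "test_fun \<Omega> g"
  shows "test_fun \<Omega> (\<lambda>x. a * f x + b * g x)"
proof -
  have sub: "closure {x. a * f x + b * g x \<noteq> 0} \<subseteq> closure {x. f x \<noteq> 0} \<union> closure {x. g x \<noteq> 0}"
    unfolding closure_Un[symmetric] by (rule closure_mono) auto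
  have "compact (closure {x. f x \<noteq> 0} \<union> closure {x. g x \<noteq> 0})"
    using assms by (intro compact_Un) (auto simp: test_fun_def)
  then have "compact (closure {x. a * f x + b * g x \<noteq> 0})"
    unfolding compact_eq_bounded_closed by (auto intro: bounded_subset[OF _ sub])
  moreover have "smooth (\<lambda>x. a * f x + b * g x)"
    using assms by (auto simp: test_fun_def intro!: smooth_add smooth_mult smooth_const)
  moreover have "closure {x. a * f x + b * g x \<noteq> 0} \<subseteq> \<Omega>"
    using sub assms unfolding test_fun_def by blast
  ultimately show ?thesis by (simp add: test_fun_def)
qed

section \<open>Polynomial approximation in C^1\<close>

lemma real_polynomial_antiderivative:
  assumes "real_polynomial_function r"
  obtains p where "real_polynomial_function p" "\<And>x. (p has_real_derivative r x) (at x)" "p 0 = c"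
proof -
  obtain a n where r: "r = (\<lambda>x. \<Sum>i\<le>n. a i * x ^ i)"
    using assms real_polynomial_function_iff_sum by blast
  define p where "p x = c + (\<Sum>i\<le>n. a i / real (Suc i) * x ^ Suc i)" for x :: real
  have "(p has_real_derivative r x) (at x)" for x
    unfolding p_def r
    by (auto intro!: derivative_eq_intros sum.cong simp: field_simps simp del: power_Suc of_nat_Suc)
  moreover have "real_polynomial_function p"
    unfolding p_def
    by (intro real_polynomial_function.intros(2-4) real_polynomial_function_sum
        real_polynomial_function_power real_polynomial_function.intros(1) bounded_linear_ident) auto
  ultimately show thesis using that[of p] by (simp add: p_def)
qed

text \<open>Weierstrass is applied to \<open>H'\<close>, and the approximating polynomial is
  integrated from the exact value \<open>H 0\<close>; the mean value inequality then controls
  \<open>p - H\<close>. The exact value at 0 matters: a polynomial that vanishes at 0 does not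
  enlarge the support of a test function.\<close>

lemma C1_polynomial_approximation:
  fixes H H' :: "real \<Rightarrow> real"
  assumes H: "\<And>x. (H has_real_derivative H' x) (at x)" and H': "continuous_on UNIV H'"
    and "e > 0"
  obtains p p' where "real_polynomial_function p" "\<And>x. (p has_real_derivative p' x) (at x)"
    "continuous_on UNIV p'" "p 0 = H 0"
    "\<And>x. \<bar>x\<bar> \<le> B \<Longrightarrow> \<bar>p x - H x\<bar> \<le> e" "\<And>x. \<bar>x\<bar> \<le> B \<Longrightarrow> \<bar>p' x - H' x\<bar> \<le> e"
proof -
  \<comment> \<open>One tolerance serves both estimates: \<open>d \<le> e\<close> for the
    derivatives, and \<open>d * \<bar>B\<bar> \<le> e\<close> for the functions after integration
    from 0. The added 1 avoids division by zero.\<close>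
  define d where "d = e / (\<bar>B\<bar> + 1)"
  have d: "d > 0" "d \<le> e" "d * \<bar>B\<bar> \<le> e"
    using \<open>e > 0\<close> by (auto simp: d_def field_simps)
  obtain r where r: "real_polynomial_function r" "\<And>x. x \<in> {-\<bar>B\<bar>..\<bar>B\<bar>} \<Longrightarrow> \<bar>H' x - r x\<bar> < d"
    using Stone_Weierstrass_real_polynomial_function[of "{-\<bar>B\<bar>..\<bar>B\<bar>}" H' d] d(1) H'
      continuous_on_subset by blast
  obtain p where p: "real_polynomial_function p" "\<And>x. (p has_real_derivative r x) (at x)" "p 0 = H 0"
    using real_polynomial_antiderivative[OF r(1)] by metis
  have rd: "\<bar>r x - H' x\<bar> \<le> d" if "\<bar>x\<bar> \<le> \<bar>B\<bar>" for x
    using r(2)[of x] that by (auto simp: abs_le_iff)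
  have "\<bar>p x - H x\<bar> \<le> e" if x: "\<bar>x\<bar> \<le> B" for x
  proof -
    have "norm ((p x - H x) - (p 0 - H 0)) \<le> d * norm (x - 0)"
    proof (rule field_differentiable_bound[of "{-\<bar>B\<bar>..\<bar>B\<bar>}" _ "\<lambda>x. r x - H' x"])
      show "((\<lambda>z. p z - H z) has_field_derivative r z - H' z) (at z within {-\<bar>B\<bar>..\<bar>B\<bar>})" for z
        using p(2) H by (intro DERIV_diff) (auto intro: has_field_derivative_at_within)
    qed (use rd x in auto)
    also have "\<dots> \<le> d * \<bar>B\<bar>" using x d by (simp add: mult_left_mono)
    finally show ?thesis using p(3) d by simp
  qed
  moreover have "continuous_on UNIV r"
    using r(1) continuous_on_polymonial_function real_polynomial_function_eq by blast
  moreover have "\<bar>r x - H' x\<bar> \<le> e" if "\<bar>x\<bar> \<le> B" for x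
    using rd[of x] d(2) that by linarith
  ultimately show thesis
    using that[of p r] p by blast
qed

subsection \<open>Convergence in \<open>L\<^sup>2\<close> and the space \<open>H\<^sub>0\<^sup>1\<close>\<close>

text \<open>A common form of \<open>L2\<close> and \<open>L2v\<close>, so that functions and their
  gradients share one set of limit lemmas.\<close>

definition sq_integrable :: "'a measure \<Rightarrow> ('a \<Rightarrow> 'b::euclidean_space) \<Rightarrow> bool" where
  "sq_integrable M f \<longleftrightarrow> f \<in> borel_measurable M \<and> integrable M (\<lambda>x. (norm (f x))\<^sup>2)"

text \<open>Square integrability is part of the notion because the integral of a non-integrable
  function is 0 by convention, so convergence of the integrals alone would carry no
  information.\<close>

definition L2_lim :: "'a measure \<Rightarrow> (nat \<Rightarrow> 'a \<Rightarrow> 'b::euclidean_space) \<Rightarrow> ('a \<Rightarrow> 'b) \<Rightarrow> bool" where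
  "L2_lim M F f \<longleftrightarrow> (\<forall>n. sq_integrable M (F n)) \<and> sq_integrable M f \<and>
     (\<lambda>n. LINT x|M. (norm (F n x - f x))\<^sup>2) \<longlonglongrightarrow> 0"

lemma norm_add_sq_le: "(norm (a + b))\<^sup>2 \<le> 2 * (norm a)\<^sup>2 + 2 * (norm b)\<^sup>2"
  for a b :: "'a::real_normed_vector"
proof -
  have "(norm (a + b))\<^sup>2 \<le> (norm a + norm b)\<^sup>2"
    by (intro power_mono norm_triangle_ineq) auto
  also have "\<dots> \<le> 2 * (norm a)\<^sup>2 + 2 * (norm b)\<^sup>2"
    using zero_le_power2[of "norm a - norm b"] by (simp add: power2_eq_square algebra_simps)
  finally show ?thesis .
qed

lemma sq_integrable_add:
  assumes "sq_integrable M f" "sq_integrable M g"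
  shows "sq_integrable M (\<lambda>x. f x + g x)"
proof -
  have [measurable]: "f \<in> borel_measurable M" "g \<in> borel_measurable M"
    using assms by (auto simp: sq_integrable_def)
  have "integrable M (\<lambda>x. (norm (f x + g x))\<^sup>2)"
  proof (rule Bochner_Integration.integrable_bound)
    show "integrable M (\<lambda>x. 2 * (norm (f x))\<^sup>2 + 2 * (norm (g x))\<^sup>2)"
      using assms by (auto simp: sq_integrable_def)
    show "AE x in M. norm ((norm (f x + g x))\<^sup>2) \<le> norm (2 * (norm (f x))\<^sup>2 + 2 * (norm (g x))\<^sup>2)"
      using norm_add_sq_le by (auto intro!: AE_I2)
  qed simp
  then show ?thesis by (simp add: sq_integrable_def)
qed

lemma sq_integrable_scaleR_bounded:
  assumes f: "sq_integrable M f" and [measurable]: "c \<in> borel_measurable M"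
    and c: "AE x in M. \<bar>c x\<bar> \<le> K"
  shows "sq_integrable M (\<lambda>x. c x *\<^sub>R f x)"
proof -
  have [measurable]: "f \<in> borel_measurable M"
    using f by (simp add: sq_integrable_def)
  have "integrable M (\<lambda>x. (norm (c x *\<^sub>R f x))\<^sup>2)"
  proof (rule Bochner_Integration.integrable_bound)
    show "integrable M (\<lambda>x. K\<^sup>2 * (norm (f x))\<^sup>2)"
      using f by (simp add: sq_integrable_def)
    show "AE x in M. norm ((norm (c x *\<^sub>R f x))\<^sup>2) \<le> norm (K\<^sup>2 * (norm (f x))\<^sup>2)"
      using c
    proof eventually_elim
      case (elim x)
      then have "\<bar>c x\<bar>\<^sup>2 \<le> K\<^sup>2" by (intro power_mono) auto
      then show ?case by (simp add: power_mult_distrib mult_right_mono)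
    qed
  qed simp
  then show ?thesis by (simp add: sq_integrable_def)
qed

lemma sq_integrable_diff:
  assumes "sq_integrable M f" "sq_integrable M g"
  shows "sq_integrable M (\<lambda>x. f x - g x)"
  using sq_integrable_add[OF assms(1) sq_integrable_scaleR_bounded[OF assms(2), of "\<lambda>_. -1" 1]]
  by simp

lemma integrable_mult_norm:
  assumes "sq_integrable M f" "sq_integrable M g"
  shows "integrable M (\<lambda>x. norm (f x) * norm (g x))"
proof (rule Bochner_Integration.integrable_bound)
  show "integrable M (\<lambda>x. (norm (f x))\<^sup>2 + (norm (g x))\<^sup>2)"
    using assms by (auto simp: sq_integrable_def)
  show "(\<lambda>x. norm (f x) * norm (g x)) \<in> borel_measurable M"
    using assms by (auto simp: sq_integrable_def)
  have "a * b \<le> a\<^sup>2 + b\<^sup>2" if "a \<ge> 0" "b \<ge> 0" for a b :: real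
    using mult_nonneg_nonneg[OF that] sum_squares_bound[of a b] by linarith
  then show "AE x in M. norm (norm (f x) * norm (g x)) \<le> norm ((norm (f x))\<^sup>2 + (norm (g x))\<^sup>2)"
    by (auto intro!: AE_I2)
qed

lemma L2_limD:
  assumes "L2_lim M F f"
  shows "sq_integrable M (F n)" "sq_integrable M f"
    "(\<lambda>n. LINT x|M. (norm (F n x - f x))\<^sup>2) \<longlonglongrightarrow> 0"
    "integrable M (\<lambda>x. (norm (F n x - f x))\<^sup>2)"
  using assms sq_integrable_diff[of M "F n" f] unfolding L2_lim_def by (auto simp: sq_integrable_def)

lemma L2_limI_bound:
  assumes "\<And>n. sq_integrable M (F n)" "sq_integrable M f"
    and e: "\<And>n. integrable M (e n)" "(\<lambda>n. LINT x|M. e n x) \<longlonglongrightarrow> 0"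
    and le: "\<And>n x. x \<in> space M \<Longrightarrow> (norm (F n x - f x))\<^sup>2 \<le> e n x"
  shows "L2_lim M F f"
proof -
  have i: "integrable M (\<lambda>x. (norm (F n x - f x))\<^sup>2)" for n
    using sq_integrable_diff[OF assms(1,2)] by (simp add: sq_integrable_def)
  have "(\<lambda>n. LINT x|M. (norm (F n x - f x))\<^sup>2) \<longlonglongrightarrow> 0"
  proof (rule tendsto_sandwich[OF _ _ tendsto_const e(2)])
    show "\<forall>\<^sub>F n in sequentially. 0 \<le> (LINT x|M. (norm (F n x - f x))\<^sup>2)"
      by (auto intro!: always_eventually)
    show "\<forall>\<^sub>F n in sequentially. (LINT x|M. (norm (F n x - f x))\<^sup>2) \<le> (LINT x|M. e n x)"
      using i e(1) le by (intro always_eventually allI integral_mono) auto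
  qed
  then show ?thesis using assms by (simp add: L2_lim_def)
qed

lemma L2_lim_add:
  assumes F: "L2_lim M F f" and G: "L2_lim M G g"
  shows "L2_lim M (\<lambda>n x. F n x + G n x) (\<lambda>x. f x + g x)"
proof (rule L2_limI_bound)
  let ?e = "\<lambda>n x. 2 * (norm (F n x - f x))\<^sup>2 + 2 * (norm (G n x - g x))\<^sup>2"
  show "integrable M (?e n)" for n
    using L2_limD(4)[OF F] L2_limD(4)[OF G] by auto
  have "(\<lambda>n. 2 * (LINT x|M. (norm (F n x - f x))\<^sup>2) + 2 * (LINT x|M. (norm (G n x - g x))\<^sup>2))
      \<longlonglongrightarrow> 2 * 0 + 2 * 0"
    by (intro tendsto_intros L2_limD(3) F G)
  then show "(\<lambda>n. LINT x|M. ?e n x) \<longlonglongrightarrow> 0"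
    using L2_limD(4)[OF F] L2_limD(4)[OF G] by simp
  show "(norm (F n x + G n x - (f x + g x)))\<^sup>2 \<le> ?e n x" for n x
    using norm_add_sq_le[of "F n x - f x" "G n x - g x"] by (simp add: algebra_simps)
qed (intro sq_integrable_add L2_limD(1)[OF F] L2_limD(1)[OF G] L2_limD(2)[OF F] L2_limD(2)[OF G])+

text \<open>Split \<open>c n * F n - c' * f\<close> into \<open>c n * (F n - f)\<close> and
  \<open>(c n - c') * f\<close>. The first part is small because \<open>c n\<close> is bounded by
  \<open>K\<close>, the second by dominated convergence.\<close>

lemma L2_lim_scaleR:
  assumes F: "L2_lim M F f" and c[measurable]: "\<And>n. c n \<in> borel_measurable M" "c' \<in> borel_measurable M"
    and K: "\<And>n x. x \<in> space M \<Longrightarrow> \<bar>c n x\<bar> \<le> K"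
    and lim: "AE x in M. (\<lambda>n. c n x) \<longlonglongrightarrow> c' x"
  shows "L2_lim M (\<lambda>n x. c n x *\<^sub>R F n x) (\<lambda>x. c' x *\<^sub>R f x)"
proof -
  have [measurable]: "F n \<in> borel_measurable M" "f \<in> borel_measurable M" for n
    using L2_limD(1,2)[OF F] by (auto simp: sq_integrable_def)
  \<comment> \<open>The limit inherits the bound \<open>K\<close> almost everywhere, hence
    \<open>\<bar>c n x - c' x\<bar> \<le> 2 * K\<close>, which yields the dominating
    function.\<close>
  have K': "AE x in M. \<bar>c' x\<bar> \<le> K"
    using lim AE_space
  proof eventually_elim
    case (elim x)
    have "(\<lambda>n. \<bar>c n x\<bar>) \<longlonglongrightarrow> \<bar>c' x\<bar>" using elim by (intro tendsto_intros)
    then show ?case by (rule LIMSEQ_le_const2) (use K elim in auto)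
  qed
  have bnd: "AE x in M. norm ((c n x - c' x)\<^sup>2 * (norm (f x))\<^sup>2) \<le> (2 * K)\<^sup>2 * (norm (f x))\<^sup>2" for n
    using K' AE_space
  proof eventually_elim
    case (elim x)
    then have "\<bar>c n x - c' x\<bar>\<^sup>2 \<le> (2 * K)\<^sup>2"
      using K[of x n] by (intro power_mono) auto
    then show ?case by (simp add: mult_right_mono)
  qed
  have lim2: "AE x in M. (\<lambda>n. (c n x - c' x)\<^sup>2 * (norm (f x))\<^sup>2) \<longlonglongrightarrow> 0"
    using lim
  proof eventually_elim
    case (elim x)
    then have "(\<lambda>n. (c n x - c' x)\<^sup>2 * (norm (f x))\<^sup>2) \<longlonglongrightarrow> (c' x - c' x)\<^sup>2 * (norm (f x))\<^sup>2"
      by (intro tendsto_intros)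
    then show ?case by simp
  qed
  have fi: "integrable M (\<lambda>x. (2 * K)\<^sup>2 * (norm (f x))\<^sup>2)"
    using L2_limD(2)[OF F] by (simp add: sq_integrable_def)
  have i2: "integrable M (\<lambda>x. (c n x - c' x)\<^sup>2 * (norm (f x))\<^sup>2)" for n
    by (rule integrable_dominated_convergence2[OF _ _ fi lim2 bnd]) auto
  have l2: "(\<lambda>n. LINT x|M. (c n x - c' x)\<^sup>2 * (norm (f x))\<^sup>2) \<longlonglongrightarrow> 0"
    using integral_dominated_convergence[OF _ _ fi lim2 bnd] by simp
  let ?e = "\<lambda>n x. 2 * (K\<^sup>2 * (norm (F n x - f x))\<^sup>2) + 2 * ((c n x - c' x)\<^sup>2 * (norm (f x))\<^sup>2)"
  show ?thesis
  proof (rule L2_limI_bound)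
    show "sq_integrable M (\<lambda>x. c n x *\<^sub>R F n x)" for n
      using K by (intro sq_integrable_scaleR_bounded[where K=K] L2_limD(1)[OF F]) auto
    show "sq_integrable M (\<lambda>x. c' x *\<^sub>R f x)"
      using K' by (intro sq_integrable_scaleR_bounded[where K=K] L2_limD(2)[OF F]) auto
    show "integrable M (?e n)" for n
      using L2_limD(4)[OF F] i2 by auto
    have "(\<lambda>n. 2 * (K\<^sup>2 * (LINT x|M. (norm (F n x - f x))\<^sup>2)) +
        2 * (LINT x|M. (c n x - c' x)\<^sup>2 * (norm (f x))\<^sup>2)) \<longlonglongrightarrow> 2 * (K\<^sup>2 * 0) + 2 * 0"
      by (intro tendsto_intros L2_limD(3) F l2)
    then show "(\<lambda>n. LINT x|M. ?e n x) \<longlonglongrightarrow> 0"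
      using L2_limD(4)[OF F] i2 by simp
    show "(norm (c n x *\<^sub>R F n x - c' x *\<^sub>R f x))\<^sup>2 \<le> ?e n x" if "x \<in> space M" for n x
    proof -
      have "\<bar>c n x\<bar>\<^sup>2 \<le> K\<^sup>2" using K[OF that] by (intro power_mono) auto
      then have "(norm (c n x *\<^sub>R (F n x - f x)))\<^sup>2 \<le> K\<^sup>2 * (norm (F n x - f x))\<^sup>2"
        by (simp add: power_mult_distrib mult_right_mono)
      moreover have "(norm ((c n x - c' x) *\<^sub>R f x))\<^sup>2 = (c n x - c' x)\<^sup>2 * (norm (f x))\<^sup>2"
        by (simp add: power_mult_distrib)
      ultimately show ?thesis
        using norm_add_sq_le[of "c n x *\<^sub>R (F n x - f x)" "(c n x - c' x) *\<^sub>R f x"]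
        by (simp add: algebra_simps)
    qed
  qed
qed

lemma L2_lim_const: "sq_integrable M f \<Longrightarrow> L2_lim M (\<lambda>_. f) f"
  by (simp add: L2_lim_def)

lemma L2_lim_subseq:
  assumes "L2_lim M F f" "strict_mono r"
  shows "L2_lim M (\<lambda>n. F (r n)) f"
  using assms LIMSEQ_subseq_LIMSEQ[OF L2_limD(3)[OF assms(1)] assms(2)]
  by (auto simp: L2_lim_def o_def)

text \<open>The squared distances tend to 0 in L^1, so a subsequence of them tends to 0 almost
  everywhere.\<close>

lemma L2_lim_AE_subseq:
  assumes "L2_lim M F f"
  obtains r where "strict_mono (r :: nat \<Rightarrow> nat)" "AE x in M. (\<lambda>n. F (r n) x) \<longlonglongrightarrow> f x"
proof -
  obtain r :: "nat \<Rightarrow> nat" where r: "strict_mono r"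
      "AE x in M. (\<lambda>n. (norm (F (r n) x - f x))\<^sup>2) \<longlonglongrightarrow> 0"
    using tendsto_L1_AE_subseq[of M "\<lambda>n x. (norm (F n x - f x))\<^sup>2"] L2_limD(3,4)[OF assms] by auto
  have "AE x in M. (\<lambda>n. F (r n) x) \<longlonglongrightarrow> f x"
    using r(2)
  proof eventually_elim
    case (elim x)
    have "(\<lambda>n. sqrt ((norm (F (r n) x - f x))\<^sup>2)) \<longlonglongrightarrow> sqrt 0"
      using elim by (intro tendsto_intros)
    then show ?case by (simp add: tendsto_norm_zero_iff LIM_zero_iff)
  qed
  with r that show thesis by blast
qed

section \<open>The space H_0^1 in terms of L^2 limits\<close>

lemma borel_measurable_lebesgue_on_continuous:
  fixes f :: "'a::euclidean_space \<Rightarrow> 'b::euclidean_space"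
  assumes "continuous_on UNIV f"
  shows "f \<in> borel_measurable (lebesgue_on \<Omega>)"
  using assms
  by (intro measurable_restrict_space1 measurable_completion) (simp add: borel_measurable_continuous_onI)

lemma sq_integrable_bounded:
  assumes "finite_measure M" "f \<in> borel_measurable M" "\<And>x. norm (f x) \<le> B"
  shows "sq_integrable M f"
proof -
  interpret finite_measure M by fact
  have "integrable M (\<lambda>x. (norm (f x))\<^sup>2)"
    using assms(2,3) by (intro integrable_const_bound[where B="B\<^sup>2"]) (auto intro!: power_mono)
  then show ?thesis using assms by (simp add: sq_integrable_def)
qed

lemma finite_measure_lebesgue_on_bounded_open:
  "open \<Omega> \<Longrightarrow> bounded \<Omega> \<Longrightarrow> finite_measure (lebesgue_on \<Omega>)"
  by (intro finite_measure_lebesgue_on lmeasurable_open)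

text \<open>Test functions and their gradients are bounded and \<open>\<Omega>\<close> has finite
  measure, so the approximants are square integrable, as \<open>L2_lim\<close> demands. In this form
  H_0^1 inherits the closure properties of \<open>L2_lim\<close>.\<close>

lemma H01_iff_L2_lim:
  fixes \<Omega> :: "'a::euclidean_space set"
  assumes "open \<Omega>" "bounded \<Omega>"
  shows "H01 \<Omega> u Du \<longleftrightarrow> (\<exists>\<phi>. (\<forall>k. test_fun \<Omega> (\<phi> k)) \<and>
      L2_lim (lebesgue_on \<Omega>) \<phi> u \<and> L2_lim (lebesgue_on \<Omega>) (\<lambda>k. grad (\<phi> k)) Du)"
proof -
  note fin = finite_measure_lebesgue_on_bounded_open[OF assms]
  have 1: "sq_integrable (lebesgue_on \<Omega>) f" if f: "test_fun \<Omega> f" for f :: "'a \<Rightarrow> real"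
  proof -
    obtain B where "\<And>x. \<bar>f x\<bar> \<le> B" using test_fun_bounded[OF f] by metis
    then show ?thesis
      using f by (intro sq_integrable_bounded[OF fin] borel_measurable_lebesgue_on_continuous
          continuous_on_smooth) (auto simp: test_fun_def)
  qed
  have 2: "sq_integrable (lebesgue_on \<Omega>) (grad f)" if f: "test_fun \<Omega> f" for f :: "'a \<Rightarrow> real"
  proof -
    obtain B where "\<And>x. norm (grad f x) \<le> B" using test_fun_grad_bounded[OF f] by metis
    then show ?thesis
      using f by (intro sq_integrable_bounded[OF fin] borel_measurable_lebesgue_on_continuous
          continuous_on_grad) (auto simp: test_fun_def)
  qed
  show ?thesis
    unfolding H01_def L2_lim_def L2_def L2v_def sq_integrable_def[of _ u] sq_integrable_def[of _ Du]
    using 1 2 by auto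
qed

lemma H01_sq_integrable:
  assumes "H01 \<Omega> u Du"
  shows "sq_integrable (lebesgue_on \<Omega>) u" "sq_integrable (lebesgue_on \<Omega>) Du"
  using assms by (auto simp: H01_def L2_def L2v_def sq_integrable_def)

lemma H01_lincomb:
  fixes \<Omega> :: "'a::euclidean_space set"
  assumes \<Omega>: "open \<Omega>" "bounded \<Omega>" and "H01 \<Omega> u Du" "H01 \<Omega> v Dv"
  shows "H01 \<Omega> (\<lambda>x. a * u x + b * v x) (\<lambda>x. a *\<^sub>R Du x + b *\<^sub>R Dv x)"
proof -
  let ?M = "lebesgue_on \<Omega>"
  obtain \<phi> where \<phi>: "\<And>k. test_fun \<Omega> (\<phi> k)" "L2_lim ?M \<phi> u" "L2_lim ?M (\<lambda>k. grad (\<phi> k)) Du"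
    using assms H01_iff_L2_lim by metis
  obtain \<psi> where \<psi>: "\<And>k. test_fun \<Omega> (\<psi> k)" "L2_lim ?M \<psi> v" "L2_lim ?M (\<lambda>k. grad (\<psi> k)) Dv"
    using assms H01_iff_L2_lim by metis
  have sc: "L2_lim ?M (\<lambda>k x. c *\<^sub>R F k x) (\<lambda>x. c *\<^sub>R f x)" if "L2_lim ?M F f"
    for c and F :: "nat \<Rightarrow> 'a \<Rightarrow> 'c::euclidean_space" and f
    using L2_lim_scaleR[OF that, of "\<lambda>_ _. c" "\<lambda>_. c" "\<bar>c\<bar>"] by simp
  have g: "grad (\<lambda>x. a * \<phi> k x + b * \<psi> k x) x = a *\<^sub>R grad (\<phi> k) x + b *\<^sub>R grad (\<psi> k) x" for k x
  proof (rule grad_eqI)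
    have "(\<phi> k has_derivative (\<lambda>h. grad (\<phi> k) x \<bullet> h)) (at x)"
         "(\<psi> k has_derivative (\<lambda>h. grad (\<psi> k) x \<bullet> h)) (at x)"
      using \<phi>(1) \<psi>(1) by (meson has_derivative_grad smooth_differentiable test_fun_smooth)+
    then show "((\<lambda>x. a * \<phi> k x + b * \<psi> k x) has_derivative
        (\<lambda>h. (a *\<^sub>R grad (\<phi> k) x + b *\<^sub>R grad (\<psi> k) x) \<bullet> h)) (at x)"
      by (auto intro!: derivative_eq_intros simp: inner_left_distrib)
  qed
  show ?thesis
    unfolding H01_iff_L2_lim[OF \<Omega>]
  proof (intro exI[of _ "\<lambda>k x. a * \<phi> k x + b * \<psi> k x"] conjI allI)
    show "test_fun \<Omega> (\<lambda>x. a * \<phi> k x + b * \<psi> k x)" for k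
      using \<phi> \<psi> test_fun_lincomb by blast
    show "L2_lim ?M (\<lambda>k x. a * \<phi> k x + b * \<psi> k x) (\<lambda>x. a * u x + b * v x)"
      using L2_lim_add[OF sc[OF \<phi>(2), of a] sc[OF \<psi>(2), of b]] by simp
    show "L2_lim ?M (\<lambda>k. grad (\<lambda>x. a * \<phi> k x + b * \<psi> k x)) (\<lambda>x. a *\<^sub>R Du x + b *\<^sub>R Dv x)"
      using L2_lim_add[OF sc[OF \<phi>(3), of a] sc[OF \<psi>(3), of b]]
      unfolding ext[OF g, symmetric] .
  qed
qed

subsection \<open>Composition, limits and measurability\<close>

lemma tendsto_of_approx_compose:
  fixes F :: "real \<Rightarrow> real"
  assumes "\<And>n. \<bar>a n - F (b n)\<bar> \<le> 1 / real (Suc n)" "b \<longlonglongrightarrow> c" "isCont F c"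
  shows "a \<longlonglongrightarrow> F c"
proof -
  have "(\<lambda>n. a n - F (b n)) \<longlonglongrightarrow> 0"
    by (rule Lim_null_comparison[OF _ LIMSEQ_Suc[OF lim_1_over_n]]) (use assms(1) in auto)
  moreover have "(\<lambda>n. F (b n)) \<longlonglongrightarrow> F c"
    using assms(2,3) isCont_tendsto_compose by blast
  ultimately have "(\<lambda>n. (a n - F (b n)) + F (b n)) \<longlonglongrightarrow> 0 + F c"
    by (rule tendsto_add)
  then show ?thesis by simp
qed

text \<open>On the (bounded) range of each approximating test function, \<open>H\<close> and \<open>T\<close> are replaced by
  polynomials that are close in \<open>C\<^sup>1\<close>; this keeps the approximants smooth although \<open>H\<close> and \<open>T\<close>
  are only of class \<open>C\<^sup>1\<close>.\<close>

lemma H01_mult_compose: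
  fixes \<Omega> :: "'a::euclidean_space set" and H H' T T' :: "real \<Rightarrow> real"
  assumes \<Omega>: "open \<Omega>" "bounded \<Omega>" and uH: "H01 \<Omega> u Du" and vH: "H01 \<Omega> v Dv"
    and H: "\<And>x. (H has_real_derivative H' x) (at x)" "continuous_on UNIV H'"
    and T: "\<And>x. (T has_real_derivative T' x) (at x)" "continuous_on UNIV T'"
    and K: "\<And>x. \<bar>H x\<bar> \<le> K" "\<And>x. \<bar>H' x\<bar> \<le> K" "\<And>x. \<bar>T x\<bar> \<le> K" "\<And>x. \<bar>T' x\<bar> \<le> K"
    and T0: "T 0 = 0"
  shows "H01 \<Omega> (\<lambda>x. H (u x) * T (v x))
     (\<lambda>x. (H (u x) * T' (v x)) *\<^sub>R Dv x + (H' (u x) * T (v x)) *\<^sub>R Du x)"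
proof -
  let ?M = "lebesgue_on \<Omega>"
  obtain \<phi>0 where \<phi>0: "\<And>k. test_fun \<Omega> (\<phi>0 k)" "L2_lim ?M \<phi>0 u" "L2_lim ?M (\<lambda>k. grad (\<phi>0 k)) Du"
    using \<Omega> uH H01_iff_L2_lim by metis
  obtain \<psi>0 where \<psi>0: "\<And>k. test_fun \<Omega> (\<psi>0 k)" "L2_lim ?M \<psi>0 v" "L2_lim ?M (\<lambda>k. grad (\<psi>0 k)) Dv"
    using \<Omega> vH H01_iff_L2_lim by metis
  \<comment> \<open>Two successive extractions give one index sequence along which both families of
    test functions converge almost everywhere.\<close>
  obtain r where r: "strict_mono (r :: nat \<Rightarrow> nat)" "AE x in ?M. (\<lambda>n. \<phi>0 (r n) x) \<longlonglongrightarrow> u x"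
    using L2_lim_AE_subseq[OF \<phi>0(2)] .
  obtain q where q: "strict_mono (q :: nat \<Rightarrow> nat)" "AE x in ?M. (\<lambda>n. \<psi>0 (r (q n)) x) \<longlonglongrightarrow> v x"
    using L2_lim_AE_subseq[OF L2_lim_subseq[OF \<psi>0(2) r(1)]] .
  define s where "s = r \<circ> q"
  have s: "strict_mono s" using r(1) q(1) by (simp add: s_def strict_mono_o)
  define \<phi> where "\<phi> n = \<phi>0 (s n)" for n
  define \<psi> where "\<psi> n = \<psi>0 (s n)" for n
  have \<phi>: "test_fun \<Omega> (\<phi> k)" "L2_lim ?M (\<lambda>k. grad (\<phi> k)) Du" for k
    using \<phi>0 L2_lim_subseq[OF \<phi>0(3) s] by (auto simp: \<phi>_def)
  have \<psi>: "test_fun \<Omega> (\<psi> k)" "L2_lim ?M (\<lambda>k. grad (\<psi> k)) Dv" for k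
    using \<psi>0 L2_lim_subseq[OF \<psi>0(3) s] by (auto simp: \<psi>_def)
  have \<phi>_AE: "AE x in ?M. (\<lambda>n. \<phi> n x) \<longlonglongrightarrow> u x"
    using r(2)
  proof eventually_elim
    case (elim x)
    from LIMSEQ_subseq_LIMSEQ[OF elim q(1)] show ?case by (simp add: \<phi>_def s_def o_def)
  qed
  have \<psi>_AE: "AE x in ?M. (\<lambda>n. \<psi> n x) \<longlonglongrightarrow> v x"
    using q(2) by (simp add: \<psi>_def s_def)
  have "\<exists>P P'. real_polynomial_function P \<and> (\<forall>t. (P has_real_derivative P' t) (at t)) \<and>
      continuous_on UNIV P' \<and> (\<forall>x. \<bar>P (\<phi> n x) - H (\<phi> n x)\<bar> \<le> 1 / real (Suc n)) \<and>
      (\<forall>x. \<bar>P' (\<phi> n x) - H' (\<phi> n x)\<bar> \<le> 1 / real (Suc n))" for n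
  proof -
    obtain B where B: "\<And>x. \<bar>\<phi> n x\<bar> \<le> B" using test_fun_bounded[OF \<phi>(1)] by metis
    obtain P P' where "real_polynomial_function P" "\<And>t. (P has_real_derivative P' t) (at t)"
      "continuous_on UNIV P'" "\<And>t. \<bar>t\<bar> \<le> B \<Longrightarrow> \<bar>P t - H t\<bar> \<le> 1 / real (Suc n)"
      "\<And>t. \<bar>t\<bar> \<le> B \<Longrightarrow> \<bar>P' t - H' t\<bar> \<le> 1 / real (Suc n)"
      by (rule C1_polynomial_approximation[OF H, of "1 / real (Suc n)" B]) auto
    then show ?thesis using B by blast
  qed
  then obtain P P' where P: "\<And>n. real_polynomial_function (P n)"
    "\<And>n t. (P n has_real_derivative P' n t) (at t)" "\<And>n. continuous_on UNIV (P' n)"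
    "\<And>n x. \<bar>P n (\<phi> n x) - H (\<phi> n x)\<bar> \<le> 1 / real (Suc n)"
    "\<And>n x. \<bar>P' n (\<phi> n x) - H' (\<phi> n x)\<bar> \<le> 1 / real (Suc n)"
    by metis
  have "\<exists>P P'. real_polynomial_function P \<and> (\<forall>t. (P has_real_derivative P' t) (at t)) \<and>
      continuous_on UNIV P' \<and> P 0 = 0 \<and> (\<forall>x. \<bar>P (\<psi> n x) - T (\<psi> n x)\<bar> \<le> 1 / real (Suc n)) \<and>
      (\<forall>x. \<bar>P' (\<psi> n x) - T' (\<psi> n x)\<bar> \<le> 1 / real (Suc n))" for n
  proof -
    obtain B where B: "\<And>x. \<bar>\<psi> n x\<bar> \<le> B" using test_fun_bounded[OF \<psi>(1)] by metis
    obtain P P' where "real_polynomial_function P" "\<And>t. (P has_real_derivative P' t) (at t)"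
      "continuous_on UNIV P'" "P 0 = T 0" "\<And>t. \<bar>t\<bar> \<le> B \<Longrightarrow> \<bar>P t - T t\<bar> \<le> 1 / real (Suc n)"
      "\<And>t. \<bar>t\<bar> \<le> B \<Longrightarrow> \<bar>P' t - T' t\<bar> \<le> 1 / real (Suc n)"
      by (rule C1_polynomial_approximation[OF T, of "1 / real (Suc n)" B]) auto
    then show ?thesis using B T0 by (intro exI[of _ P] exI[of _ P']) auto
  qed
  then obtain Q Q' where Q: "\<And>n. real_polynomial_function (Q n)"
    "\<And>n t. (Q n has_real_derivative Q' n t) (at t)" "\<And>n. continuous_on UNIV (Q' n)"
    "\<And>n. Q n 0 = 0" "\<And>n x. \<bar>Q n (\<psi> n x) - T (\<psi> n x)\<bar> \<le> 1 / real (Suc n)"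
    "\<And>n x. \<bar>Q' n (\<psi> n x) - T' (\<psi> n x)\<bar> \<le> 1 / real (Suc n)"
    by metis
  have "K \<ge> 0" using K(1)[of 0] by simp
  \<comment> \<open>On the range of the test functions the polynomials differ from \<open>H\<close>,
    \<open>T\<close> and their derivatives by at most 1, so \<open>K + 1\<close> bounds them
    uniformly in \<open>n\<close>.\<close>
  have near: "\<bar>a\<bar> \<le> K + 1" if "\<bar>a - b\<bar> \<le> 1 / real (Suc n)" "\<bar>b\<bar> \<le> K" for a b :: real and n
  proof -
    have "1 / real (Suc n) \<le> 1" by simp
    with that show ?thesis by linarith
  qed
  note bd = near[OF P(4) K(1)] near[OF P(5) K(2)] near[OF Q(5) K(3)] near[OF Q(6) K(4)]
  have bd2: "\<bar>a * b\<bar> \<le> (K + 1) * (K + 1)" if "\<bar>a\<bar> \<le> K + 1" "\<bar>b\<bar> \<le> K + 1" for a b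
    using that \<open>K \<ge> 0\<close> by (auto simp: abs_mult intro!: mult_mono)
  have Hc: "continuous_on UNIV H" and Tc: "continuous_on UNIV T"
    using H(1) T(1) by (meson DERIV_isCont continuous_at_imp_continuous_on)+
  have ic: "isCont F t" if "continuous_on UNIV F" for F :: "real \<Rightarrow> real" and t
    using that by (simp add: continuous_on_eq_continuous_at)
  have limH: "AE x in ?M. (\<lambda>n. P n (\<phi> n x)) \<longlonglongrightarrow> H (u x)"
    using \<phi>_AE by eventually_elim (rule tendsto_of_approx_compose[OF P(4) _ ic[OF Hc]])
  have limH': "AE x in ?M. (\<lambda>n. P' n (\<phi> n x)) \<longlonglongrightarrow> H' (u x)"
    using \<phi>_AE by eventually_elim (rule tendsto_of_approx_compose[OF P(5) _ ic[OF H(2)]])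
  have limT: "AE x in ?M. (\<lambda>n. Q n (\<psi> n x)) \<longlonglongrightarrow> T (v x)"
    using \<psi>_AE by eventually_elim (rule tendsto_of_approx_compose[OF Q(5) _ ic[OF Tc]])
  have limT': "AE x in ?M. (\<lambda>n. Q' n (\<psi> n x)) \<longlonglongrightarrow> T' (v x)"
    using \<psi>_AE by eventually_elim (rule tendsto_of_approx_compose[OF Q(6) _ ic[OF T(2)]])
  have um[measurable]: "u \<in> borel_measurable ?M" and vm[measurable]: "v \<in> borel_measurable ?M"
    using uH vH by (auto dest: H01_sq_integrable simp: sq_integrable_def)
  have [measurable]: "H \<in> borel_measurable borel" "H' \<in> borel_measurable borel"
     "T \<in> borel_measurable borel" "T' \<in> borel_measurable borel"
    using Hc H(2) Tc T(2) by (auto intro: borel_measurable_continuous_onI)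
  have Pc: "continuous_on UNIV (P n)" and Qc: "continuous_on UNIV (Q n)" for n
    using P(2) Q(2) by (meson DERIV_isCont continuous_at_imp_continuous_on)+
  have [measurable]: "P n \<in> borel_measurable borel" "P' n \<in> borel_measurable borel"
     "Q n \<in> borel_measurable borel" "Q' n \<in> borel_measurable borel" for n
    using Pc Qc P(3) Q(3) by (auto intro: borel_measurable_continuous_onI)
  have [measurable]: "\<phi> n \<in> borel_measurable ?M" "\<psi> n \<in> borel_measurable ?M" for n
    using \<phi>(1) \<psi>(1) by (auto intro!: borel_measurable_lebesgue_on_continuous continuous_on_smooth
        dest: test_fun_smooth)
  define g where "g n x = P n (\<phi> n x) * Q n (\<psi> n x)" for n x
  have grad_g: "grad (g n) x = (P n (\<phi> n x) * Q' n (\<psi> n x)) *\<^sub>R grad (\<psi> n) x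
        + (P' n (\<phi> n x) * Q n (\<psi> n x)) *\<^sub>R grad (\<phi> n) x" for n x
  proof (rule grad_eqI)
    have d: "(\<phi> n has_derivative (\<lambda>h. grad (\<phi> n) x \<bullet> h)) (at x)"
         "(\<psi> n has_derivative (\<lambda>h. grad (\<psi> n) x \<bullet> h)) (at x)"
      using \<phi>(1) \<psi>(1) by (meson has_derivative_grad smooth_differentiable test_fun_smooth)+
    have "((\<lambda>x. P n (\<phi> n x)) has_derivative (\<lambda>h. P' n (\<phi> n x) * (grad (\<phi> n) x \<bullet> h))) (at x)"
      using has_derivative_compose[OF d(1) P(2)[unfolded has_field_derivative_def]] .
    moreover have "((\<lambda>x. Q n (\<psi> n x)) has_derivative (\<lambda>h. Q' n (\<psi> n x) * (grad (\<psi> n) x \<bullet> h))) (at x)"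
      using has_derivative_compose[OF d(2) Q(2)[unfolded has_field_derivative_def]] .
    ultimately show "(g n has_derivative (\<lambda>h. ((P n (\<phi> n x) * Q' n (\<psi> n x)) *\<^sub>R grad (\<psi> n) x
        + (P' n (\<phi> n x) * Q n (\<psi> n x)) *\<^sub>R grad (\<phi> n) x) \<bullet> h)) (at x)"
      unfolding g_def
      by (auto intro!: derivative_eq_intros simp: inner_left_distrib algebra_simps)
  qed
  \<comment> \<open>Since \<open>Q n 0 = 0\<close>, the product vanishes wherever
    \<open>\<psi> n\<close> does, so its support lies in that of \<open>\<psi> n\<close>.\<close>
  have test: "test_fun \<Omega> (g n)" for n
  proof (rule test_fun_support_mono[OF \<psi>(1)[of n]])
    show "smooth (g n)"
      unfolding g_def
      by (rule smooth_mult[OF smooth_real_polynomial[OF P(1) test_fun_smooth[OF \<phi>(1)]]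
            smooth_real_polynomial[OF Q(1) test_fun_smooth[OF \<psi>(1)]]])
  qed (simp add: g_def Q(4))
  \<comment> \<open>The constant 1 is square integrable on a domain of finite measure; the
    convergence of \<open>g n\<close> is then the case of \<open>L2_lim_scaleR\<close> with
    coefficients \<open>g n\<close> and the fixed function 1.\<close>
  have one: "sq_integrable ?M (\<lambda>_. 1::real)"
    by (rule sq_integrable_bounded[OF finite_measure_lebesgue_on_bounded_open[OF \<Omega>], of _ 1]) auto
  have conv: "AE x in ?M. (\<lambda>n. a n x * b n x) \<longlonglongrightarrow> c x * d x"
    if "AE x in ?M. (\<lambda>n. a n x) \<longlonglongrightarrow> c x" "AE x in ?M. (\<lambda>n. b n x) \<longlonglongrightarrow> d x"
    for a b :: "nat \<Rightarrow> 'a \<Rightarrow> real" and c d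
    using that by eventually_elim (rule tendsto_mult)
  have "L2_lim ?M (\<lambda>n x. g n x *\<^sub>R 1) (\<lambda>x. (H (u x) * T (v x)) *\<^sub>R (1::real))"
    unfolding g_def
    by (rule L2_lim_scaleR[OF L2_lim_const[OF one] _ _ _ conv[OF limH limT]])
       (auto intro: bd2 bd)
  then have L1: "L2_lim ?M g (\<lambda>x. H (u x) * T (v x))" by simp
  have "L2_lim ?M (\<lambda>n x. (P n (\<phi> n x) * Q' n (\<psi> n x)) *\<^sub>R grad (\<psi> n) x
        + (P' n (\<phi> n x) * Q n (\<psi> n x)) *\<^sub>R grad (\<phi> n) x)
     (\<lambda>x. (H (u x) * T' (v x)) *\<^sub>R Dv x + (H' (u x) * T (v x)) *\<^sub>R Du x)"
    by (intro L2_lim_add L2_lim_scaleR[OF \<psi>(2) _ _ _ conv[OF limH limT']]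
         L2_lim_scaleR[OF \<phi>(2) _ _ _ conv[OF limH' limT]]) (auto intro: bd2 bd)
  then have "L2_lim ?M (\<lambda>n. grad (g n))
     (\<lambda>x. (H (u x) * T' (v x)) *\<^sub>R Dv x + (H' (u x) * T (v x)) *\<^sub>R Du x)"
    unfolding ext[OF grad_g, symmetric] .
  with L1 test show ?thesis
    unfolding H01_iff_L2_lim[OF \<Omega>] by blast
qed

section \<open>Limits of the functional and of the integrals\<close>

lemma Hminus1_tendsto:
  assumes \<Omega>: "open \<Omega>" "bounded \<Omega>" and w: "Hminus1 \<Omega> w" and v: "H01 \<Omega> v Dv"
    and z: "\<And>n. H01 \<Omega> (z n) (Dz n)" and lim: "L2_lim (lebesgue_on \<Omega>) Dz Dv"
  shows "(\<lambda>n. w (z n)) \<longlonglongrightarrow> w v"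
proof -
  obtain C where C: "\<And>z Dz. H01 \<Omega> z Dz \<Longrightarrow> \<bar>w z\<bar> \<le> C * sqrt (LINT x|lebesgue_on \<Omega>. (norm (Dz x))\<^sup>2)"
    using w unfolding Hminus1_def by blast
  have "\<bar>w (z n) - w v\<bar> \<le> C * sqrt (LINT x|lebesgue_on \<Omega>. (norm (Dz n x - Dv x))\<^sup>2)" for n
  proof -
    \<comment> \<open>Linearity turns the difference of values into the value at
      \<open>z n - v\<close>, whose gradient is \<open>Dz n - Dv\<close>; the bound in
      \<open>Hminus1\<close> then measures the distance of the gradients.\<close>
    have "w (\<lambda>x. 1 * z n x + (-1) * v x) = 1 * w (z n) + (-1) * w v"
      using w z[of n] v unfolding Hminus1_def by blast
    with C[OF H01_lincomb[OF \<Omega> z[of n] v, of 1 "-1"]] show ?thesis by simp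
  qed
  moreover have "(\<lambda>n. C * sqrt (LINT x|lebesgue_on \<Omega>. (norm (Dz n x - Dv x))\<^sup>2)) \<longlonglongrightarrow> C * sqrt 0"
    by (intro tendsto_intros L2_limD(3)[OF lim])
  ultimately have "(\<lambda>n. w (z n) - w v) \<longlonglongrightarrow> 0"
    by (intro Lim_null_comparison[of "\<lambda>n. w (z n) - w v"]) auto
  then show ?thesis by (simp add: LIM_zero_iff)
qed

text \<open>Fatou's lemma gives integrability of the limits, which then serve as dominating functions.\<close>

lemma integral_sum_limit_dominated_by_limit:
  fixes f g \<eta> :: "'a \<Rightarrow> real"
  assumes F: "\<And>n. integrable M (F n)" and G: "\<And>n. integrable M (G n)"
    and [measurable]: "f \<in> borel_measurable M" "g \<in> borel_measurable M"
    and \<eta>: "integrable M \<eta>"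
    and F_lim: "AE x in M. (\<lambda>n. F n x) \<longlonglongrightarrow> f x" and G_lim: "AE x in M. (\<lambda>n. G n x) \<longlonglongrightarrow> g x"
    and F_ge: "\<And>n. AE x in M. - \<eta> x \<le> F n x" and G_ge: "\<And>n. AE x in M. - \<eta> x \<le> G n x"
    and F_le: "\<And>n. AE x in M. \<bar>F n x\<bar> \<le> \<bar>f x\<bar>" and G_le: "\<And>n. AE x in M. \<bar>G n x\<bar> \<le> \<bar>g x\<bar>"
    and L: "(\<lambda>n. (LINT x|M. F n x) + (LINT x|M. G n x)) \<longlonglongrightarrow> L"
  shows "integrable M f" "integrable M g" "(LINT x|M. f x) + (LINT x|M. g x) = L"
proof -
  \<comment> \<open>The limit is known for the sum of the two integrals, so Fatou is applied to the
    sum. The shift by \<open>2 * \<eta>\<close> makes it nonnegative almost everywhere.\<close>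
  define h where "h n x = F n x + G n x + 2 * \<eta> x" for n x
  define k where "k x = f x + g x + 2 * \<eta> x" for x
  have [measurable]: "\<eta> \<in> borel_measurable M" using \<eta> by auto
  have h: "integrable M (h n)" for n
    unfolding h_def using F G \<eta> by auto
  have h0: "AE x in M. 0 \<le> h n x" for n
    using F_ge[of n] G_ge[of n] by eventually_elim (simp add: h_def)
  have hk: "AE x in M. (\<lambda>n. h n x) \<longlonglongrightarrow> k x"
    using F_lim G_lim unfolding h_def k_def by eventually_elim (intro tendsto_intros)
  have f_ge: "AE x in M. - \<eta> x \<le> f x"
  proof -
    have "AE x in M. \<forall>n. - \<eta> x \<le> F n x" using F_ge by (simp add: AE_all_countable)
    with F_lim show ?thesis by eventually_elim (rule LIMSEQ_le_const, auto)
  qed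
  have g_ge: "AE x in M. - \<eta> x \<le> g x"
  proof -
    have "AE x in M. \<forall>n. - \<eta> x \<le> G n x" using G_ge by (simp add: AE_all_countable)
    with G_lim show ?thesis by eventually_elim (rule LIMSEQ_le_const, auto)
  qed
  have hL: "(\<lambda>n. LINT x|M. h n x) \<longlonglongrightarrow> L + 2 * (LINT x|M. \<eta> x)"
    using tendsto_add[OF L tendsto_const[of "2 * (LINT x|M. \<eta> x)"]] F G \<eta> by (simp add: h_def)
  have "(\<integral>\<^sup>+x. ennreal (k x) \<partial>M) = (\<integral>\<^sup>+x. liminf (\<lambda>n. ennreal (h n x)) \<partial>M)"
  proof (rule nn_integral_cong_AE, use hk in eventually_elim)
    case (elim x)
    then have "(\<lambda>n. ennreal (h n x)) \<longlonglongrightarrow> ennreal (k x)" by (rule tendsto_ennrealI)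
    then show ?case by (simp add: lim_imp_Liminf)
  qed
  also have "\<dots> \<le> liminf (\<lambda>n. \<integral>\<^sup>+x. ennreal (h n x) \<partial>M)"
    using h by (intro nn_integral_liminf) auto
  also have "\<dots> = liminf (\<lambda>n. ennreal (LINT x|M. h n x))"
    using nn_integral_eq_integral[OF h h0] by simp
  also have "\<dots> = ennreal (L + 2 * (LINT x|M. \<eta> x))"
    using tendsto_ennrealI[OF hL] by (simp add: lim_imp_Liminf)
  finally have "(\<integral>\<^sup>+x. ennreal (k x) \<partial>M) \<le> ennreal (L + 2 * (LINT x|M. \<eta> x))" .
  then have fin: "(\<integral>\<^sup>+x. ennreal (k x) \<partial>M) < \<infinity>"
    by (rule order.strict_trans1) simp
  have k0: "AE x in M. 0 \<le> k x"
    using f_ge g_ge by eventually_elim (simp add: k_def)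
  have "k \<in> borel_measurable M" unfolding k_def by measurable
  then have k: "integrable M k"
    using fin k0 by (intro integrableI_nonneg)
  \<comment> \<open>\<open>k\<close> is the sum of \<open>f + \<eta>\<close> and
    \<open>g + \<eta>\<close>, both nonnegative almost everywhere, so \<open>k\<close> dominates
    each of them and \<open>k + \<bar>\<eta>\<bar>\<close> dominates \<open>f\<close> and
    \<open>g\<close>.\<close>
  have bound: "integrable M (\<lambda>x. k x + \<bar>\<eta> x\<bar>)"
    using k \<eta> by auto
  show f: "integrable M f"
  proof (rule Bochner_Integration.integrable_bound[OF bound])
    show "AE x in M. norm (f x) \<le> norm (k x + \<bar>\<eta> x\<bar>)"
      using f_ge g_ge by eventually_elim (auto simp: k_def)
  qed simp
  show g: "integrable M g"
  proof (rule Bochner_Integration.integrable_bound[OF bound])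
    show "AE x in M. norm (g x) \<le> norm (k x + \<bar>\<eta> x\<bar>)"
      using f_ge g_ge by eventually_elim (auto simp: k_def)
  qed simp
  have "(\<lambda>n. LINT x|M. F n x) \<longlonglongrightarrow> (LINT x|M. f x)"
    by (rule integral_dominated_convergence[where w="\<lambda>x. \<bar>f x\<bar>"]) (use f F F_lim F_le in auto)
  moreover have "(\<lambda>n. LINT x|M. G n x) \<longlonglongrightarrow> (LINT x|M. g x)"
    by (rule integral_dominated_convergence[where w="\<lambda>x. \<bar>g x\<bar>"]) (use g G G_lim G_le in auto)
  ultimately have "(\<lambda>n. (LINT x|M. F n x) + (LINT x|M. G n x)) \<longlonglongrightarrow> (LINT x|M. f x) + (LINT x|M. g x)"
    by (rule tendsto_add)
  then show "(LINT x|M. f x) + (LINT x|M. g x) = L"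
    using L LIMSEQ_unique by blast
qed

section \<open>Measurability of Caratheodory compositions\<close>

lemma borel_measurable_Caratheodory:
  fixes f :: "'a \<Rightarrow> 'b::{metric_space, second_countable_topology} \<Rightarrow> 'c::metric_space"
  assumes meas: "\<And>y. (\<lambda>x. f x y) \<in> borel_measurable M"
    and cont: "\<And>x. x \<in> space M \<Longrightarrow> continuous_on UNIV (f x)"
    and g: "g \<in> borel_measurable M"
  shows "(\<lambda>x. f x (g x)) \<in> borel_measurable M"
proof -
  \<comment> \<open>Along a simple function the composition is measurable, since finitely many
    values occur and \<open>f\<close> is measurable in \<open>x\<close> for each of them. Continuity
    in the second argument passes this to the limit.\<close>
  obtain F where F: "\<And>i. simple_function M (F i)" "\<And>x. x \<in> space M \<Longrightarrow> (\<lambda>i. F i x) \<longlonglongrightarrow> g x"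
    using borel_measurable_implies_sequence_metric[OF g] by blast
  show ?thesis
  proof (rule borel_measurable_LIMSEQ_metric[of "\<lambda>i x. f x (F i x)"])
    fix i
    have "F i \<in> measurable M (count_space (F i ` space M))"
      using F(1)[of i] by (auto simp: simple_function_def measurable_count_space_eq2)
    moreover have "countable (F i ` space M)"
      using F(1)[of i] by (simp add: simple_function_def countable_finite)
    ultimately show "(\<lambda>x. f x (F i x)) \<in> borel_measurable M"
      using measurable_compose_countable'[of "F i ` space M" "\<lambda>y x. f x y" M borel "F i"] meas
      by blast
  next
    fix x assume "x \<in> space M"
    then show "(\<lambda>i. f x (F i x)) \<longlonglongrightarrow> f x (g x)"
      using F(2) cont by (intro continuous_on_tendsto_compose[of UNIV "f x"]) auto
  qed
qed

subsection \<open>Extension of the class of test functions\<close>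

definition cutoff :: "real \<Rightarrow> real \<Rightarrow> real" where
  "cutoff N s = (max 0 (1 - (s / N\<^sup>2)\<^sup>2))\<^sup>2"

definition cutoff' :: "real \<Rightarrow> real \<Rightarrow> real" where
  "cutoff' N s = - 4 * (s / N\<^sup>2) * max 0 (1 - (s / N\<^sup>2)\<^sup>2) / N\<^sup>2"

text \<open>A smooth substitute for truncation at a height of order \<open>N\<close>: odd,
  increasing, bounded, and a contraction that fixes 0.\<close>

definition trunc :: "real \<Rightarrow> real \<Rightarrow> real" where
  "trunc N s = N * arctan (s / N)"

definition trunc' :: "real \<Rightarrow> real \<Rightarrow> real" where
  "trunc' N s = 1 / (1 + (s / N)\<^sup>2)"

text \<open>Squaring removes the corner of the positive part, which makes \<open>cutoff\<close> of
  class C^1 at the ends of its support. At 0 the factorization \<open>max 0 z * z\<close> with a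
  continuous factor is Caratheodory's criterion.\<close>

lemma has_real_derivative_pos_part_sq:
  "((\<lambda>y. (max 0 y)\<^sup>2) has_real_derivative 2 * max 0 y) (at y)" for y :: real
proof -
  consider "y < 0" | "y = 0" | "y > 0" by linarith
  then show ?thesis
  proof cases
    case 1
    have "((\<lambda>_. 0) has_real_derivative 0) (at y)" by simp
    then have "((\<lambda>y. (max 0 y)\<^sup>2) has_real_derivative 0) (at y)"
      by (rule has_field_derivative_transform_within_open[where S="{..<0}"]) (use 1 in auto)
    then show ?thesis using 1 by simp
  next
    case 2
    have "isCont (\<lambda>z::real. max 0 z) 0" by (intro continuous_intros)
    moreover have "(max 0 z)\<^sup>2 = max 0 z * z" for z :: real
      by (simp add: max_def power2_eq_square)
    ultimately show ?thesis
      unfolding DERIV_caratheodory_within by (intro exI[of _ "\<lambda>z. max 0 z"]) (simp add: 2)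
  next
    case 3
    have "((\<lambda>y. y\<^sup>2) has_real_derivative 2 * y) (at y)"
      by (auto intro!: derivative_eq_intros)
    then have "((\<lambda>y. (max 0 y)\<^sup>2) has_real_derivative 2 * y) (at y)"
      by (rule has_field_derivative_transform_within_open[where S="{0<..}"]) (use 3 in auto)
    then show ?thesis using 3 by simp
  qed
qed

lemma has_real_derivative_cutoff:
  assumes "N > 0"
  shows "(cutoff N has_real_derivative cutoff' N s) (at s)"
proof -
  have "((\<lambda>s. 1 - (s / N\<^sup>2)\<^sup>2) has_real_derivative - 2 * (s / N\<^sup>2) / N\<^sup>2) (at s)"
    using assms by (auto intro!: derivative_eq_intros simp: field_simps power2_eq_square)
  from DERIV_chain2[OF has_real_derivative_pos_part_sq this] show ?thesis
    unfolding cutoff_def cutoff'_def by (simp add: algebra_simps)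
qed

lemma continuous_on_cutoff': "continuous_on S (cutoff' N)"
  unfolding cutoff'_def[abs_def] divide_inverse by (intro continuous_intros)

lemma cutoff_range: "0 \<le> cutoff N s" "cutoff N s \<le> 1"
  by (auto simp: cutoff_def power_le_one_iff max_def)

lemma cutoff_eq_0:
  assumes "N > 0" "\<bar>s\<bar> > N\<^sup>2"
  shows "cutoff N s = 0"
proof -
  have "1 \<le> \<bar>s / N\<^sup>2\<bar>" using assms by (simp add: field_simps)
  then have "1 \<le> (s / N\<^sup>2)\<^sup>2" using one_le_power[of "\<bar>s / N\<^sup>2\<bar>" 2] by (simp only: power2_abs)
  then show ?thesis by (simp add: cutoff_def)
qed

text \<open>In the rescaled variable \<open>r = s / N\<^sup>2\<close> the product
  \<open>r * max 0 (1 - r\<^sup>2)\<close> has modulus at most 1 for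
  \<open>\<bar>r\<bar> \<le> 1\<close> and vanishes otherwise; the remaining factor is
  \<open>4 / N\<^sup>2\<close>.\<close>

lemma abs_cutoff'_le:
  assumes "N > 0"
  shows "\<bar>cutoff' N s\<bar> \<le> 4 / N\<^sup>2"
proof -
  define r where "r = s / N\<^sup>2"
  have "\<bar>r * max 0 (1 - r\<^sup>2)\<bar> \<le> 1"
  proof (cases "\<bar>r\<bar> \<le> 1")
    case True
    then show ?thesis
      unfolding abs_mult by (intro mult_le_one) (auto simp: max_def abs_square_le_1)
  next
    case False
    then have "1 \<le> r\<^sup>2" using one_le_power[of "\<bar>r\<bar>" 2] by simp
    then show ?thesis by simp
  qed
  moreover have "\<bar>cutoff' N s\<bar> = 4 * \<bar>r * max 0 (1 - r\<^sup>2)\<bar> / N\<^sup>2"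
    by (simp add: cutoff'_def r_def abs_mult)
  ultimately show ?thesis by (simp add: divide_right_mono)
qed

lemma has_real_derivative_trunc:
  assumes "N > 0"
  shows "(trunc N has_real_derivative trunc' N s) (at s)"
  unfolding trunc_def[abs_def] trunc'_def using assms
  by (auto intro!: derivative_eq_intros simp: divide_inverse)

lemma continuous_on_trunc': "continuous_on S (trunc' N)"
proof -
  have "1 + (s / N)\<^sup>2 \<noteq> 0" for s :: real
    using zero_le_power2[of "s / N"] by linarith
  then show ?thesis
    unfolding trunc'_def[abs_def] divide_inverse by (intro continuous_intros) (auto simp: divide_inverse)
qed

lemma trunc'_range: "0 \<le> trunc' N s" "trunc' N s \<le> 1"
  by (auto simp: trunc'_def field_simps add_pos_nonneg)

lemma abs_trunc_le_const:
  assumes "N > 0"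
  shows "\<bar>trunc N s\<bar> \<le> 2 * N"
proof -
  \<comment> \<open>The integer 2 replaces the sharp bound \<open>pi / 2\<close>.\<close>
  have "\<bar>arctan (s / N)\<bar> \<le> 2"
    using arctan_bounded[of "s / N"] pi_less_4 by linarith
  then show ?thesis using assms by (simp add: trunc_def abs_mult)
qed

lemma abs_trunc_le:
  assumes "N > 0"
  shows "\<bar>trunc N s\<bar> \<le> \<bar>s\<bar>"
proof -
  have "norm (trunc N s - trunc N 0) \<le> 1 * norm (s - 0)"
    by (rule field_differentiable_bound[of UNIV _ "trunc' N"])
       (use has_real_derivative_trunc[OF assms] trunc'_range in auto)
  then show ?thesis by (simp add: trunc_def)
qed

lemma trunc_mult_nonneg: "N > 0 \<Longrightarrow> 0 \<le> trunc N s * s"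
  by (cases "s \<ge> 0") (auto simp: trunc_def zero_le_mult_iff mult_le_0_iff divide_nonpos_pos)

lemma tendsto_cutoff: "(\<lambda>n. cutoff (real (Suc n)) s) \<longlonglongrightarrow> 1"
proof -
  have "(\<lambda>n. 1 / real (Suc n)) \<longlonglongrightarrow> 0" by (rule LIMSEQ_Suc[OF lim_1_over_n])
  then have "(\<lambda>n. (max 0 (1 - (s * (1 / real (Suc n))\<^sup>2)\<^sup>2))\<^sup>2) \<longlonglongrightarrow> (max 0 (1 - (s * 0\<^sup>2)\<^sup>2))\<^sup>2"
    by (intro tendsto_intros)
  then show ?thesis by (simp add: cutoff_def power_inverse divide_inverse)
qed

lemma tendsto_trunc': "(\<lambda>n. trunc' (real (Suc n)) s) \<longlonglongrightarrow> 1"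
proof -
  have "(\<lambda>n. 1 / real (Suc n)) \<longlonglongrightarrow> 0" by (rule LIMSEQ_Suc[OF lim_1_over_n])
  then have "(\<lambda>n. 1 / (1 + (s * (1 / real (Suc n)))\<^sup>2)) \<longlonglongrightarrow> 1 / (1 + (s * 0)\<^sup>2)"
    by (intro tendsto_intros) auto
  then show ?thesis by (simp add: trunc'_def divide_inverse)
qed

text \<open>For \<open>s \<noteq> 0\<close> the value is \<open>s * (arctan h / h)\<close> with
  \<open>h = s / N\<close>, and the quotient tends to 1, the derivative of \<open>arctan\<close> at
  0.\<close>

lemma tendsto_trunc: "(\<lambda>n. trunc (real (Suc n)) s) \<longlonglongrightarrow> s"
proof (cases "s = 0")
  case True
  then show ?thesis by (simp add: trunc_def)
next
  case False
  have "(arctan has_real_derivative 1) (at 0)"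
    using DERIV_arctan[of 0] by simp
  then have "((\<lambda>h. arctan h / h) \<longlongrightarrow> 1) (at 0)"
    by (simp add: DERIV_def)
  moreover have "filterlim (\<lambda>n. s / real (Suc n)) (at 0) sequentially"
  proof -
    have "(\<lambda>n. s * (1 / real (Suc n))) \<longlonglongrightarrow> s * 0"
      by (intro tendsto_intros LIMSEQ_Suc[OF lim_1_over_n])
    then show ?thesis using False by (auto simp: filterlim_at)
  qed
  ultimately have "(\<lambda>n. arctan (s / real (Suc n)) / (s / real (Suc n))) \<longlonglongrightarrow> 1"
    by (rule filterlim_compose)
  then have "(\<lambda>n. s * (arctan (s / real (Suc n)) / (s / real (Suc n)))) \<longlonglongrightarrow> s * 1"
    by (intro tendsto_intros)
  then show ?thesis using False by (simp add: trunc_def mult.commute)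
qed

section \<open>Lower bounds that survive contraction\<close>

lemma mult_ge_of_contraction:
  fixes b t v e :: real
  assumes "e \<le> b * v" "0 \<le> t * v" "\<bar>t\<bar> \<le> \<bar>v\<bar>"
  shows "- \<bar>e\<bar> \<le> b * t" "\<bar>b * t\<bar> \<le> \<bar>b * v\<bar>"
proof -
  show "\<bar>b * t\<bar> \<le> \<bar>b * v\<bar>"
    using assms(3) by (simp add: abs_mult mult_left_mono)
  show "- \<bar>e\<bar> \<le> b * t"
  proof (cases "b * t \<ge> 0")
    \<comment> \<open>As \<open>t\<close> does not have the opposite sign to \<open>v\<close>, a
      negative \<open>b * t\<close> forces \<open>b * v \<le> 0\<close>. The smaller modulus then
      keeps \<open>b * t\<close> above \<open>b * v\<close>, and so above \<open>e\<close>.\<close>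
    case False
    then have "b * v \<le> 0"
      using assms(2,3) by (smt (verit) mult_le_0_iff zero_le_mult_iff)
    then show ?thesis
      using \<open>\<bar>b * t\<bar> \<le> \<bar>b * v\<bar>\<close> assms(1) by linarith
  qed simp
qed

text \<open>A factor in the unit interval moves \<open>y\<close> toward 0. This form serves the
  gradient term; the preceding one serves the zero-order term.\<close>

lemma mult_ge_of_unit_interval:
  fixes c y e :: real
  assumes "e \<le> y" "0 \<le> c" "c \<le> 1"
  shows "- \<bar>e\<bar> \<le> c * y" "\<bar>c * y\<bar> \<le> \<bar>y\<bar>"
proof -
  show le: "\<bar>c * y\<bar> \<le> \<bar>y\<bar>"
    using assms by (simp add: abs_mult mult_left_le_one_le)
  show "- \<bar>e\<bar> \<le> c * y"
  proof (cases "y \<ge> 0")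
    case True
    then show ?thesis using mult_nonneg_nonneg[OF assms(2)] by (smt (verit))
  next
    case False
    then show ?thesis using le assms(1) by linarith
  qed
qed


lemma borel_measurable_compose_deriv:
  fixes F :: "real \<Rightarrow> real"
  assumes "\<And>x. (F has_real_derivative F' x) (at x)" "f \<in> borel_measurable M"
  shows "(\<lambda>x. F (f x)) \<in> borel_measurable M"
proof -
  have "continuous_on UNIV F"
    using assms(1) by (meson DERIV_isCont continuous_at_imp_continuous_on)
  then show ?thesis
    using assms(2) by (auto intro: measurable_compose[OF _ borel_measurable_continuous_onI])
qed

text \<open>With \<open>T\<^sub>n\<close> bounded by \<open>2N\<close> and \<open>H\<^sub>n\<close> supported in \<open>[-N\<^sup>2, N\<^sup>2]\<close>, where \<open>N = n + 1\<close>, the error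
  coefficient \<open>H\<^sub>n'(u) T\<^sub>n(v)\<close> is of order \<open>1/N\<close>, so one limit handles both truncations.\<close>

lemma weak_equation_extends:
  fixes \<Omega> :: "'a::euclidean_space set" and A :: "'a \<Rightarrow> 'a" and B :: "'a \<Rightarrow> real"
    and a b :: "real \<Rightarrow> real"
  assumes \<Omega>: "open \<Omega>" "bounded \<Omega>" and uH: "H01 \<Omega> u Du"
    and A[measurable]: "A \<in> borel_measurable (lebesgue_on \<Omega>)"
    and B[measurable]: "B \<in> borel_measurable (lebesgue_on \<Omega>)"
    and a: "mono_on {0..} a" "\<And>t. t \<ge> 0 \<Longrightarrow> a t \<ge> 0"
    and b: "mono_on {0..} b" "\<And>t. t \<ge> 0 \<Longrightarrow> b t \<ge> 0"
    and A_le: "\<And>x. x \<in> \<Omega> \<Longrightarrow> norm (A x) \<le> a \<bar>u x\<bar> * norm (Du x)"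
    and B_le: "\<And>x. x \<in> \<Omega> \<Longrightarrow> \<bar>B x\<bar> \<le> b \<bar>u x\<bar> * (norm (Du x))\<^sup>2"
    and w: "Hminus1 \<Omega> w"
    and u_eq: "\<And>z Dz. in_Vu \<Omega> u z Dz \<Longrightarrow>
        (LINT x|lebesgue_on \<Omega>. A x \<bullet> Dz x) + (LINT x|lebesgue_on \<Omega>. B x * z x) = w z"
    and u_int: "integrable (lebesgue_on \<Omega>) (\<lambda>x. A x \<bullet> Du x)"
    and vH: "H01 \<Omega> v Dv"
    and \<eta>: "integrable (lebesgue_on \<Omega>) \<eta>"
    and v_ge1: "AE x in lebesgue_on \<Omega>. B x * v x \<ge> \<eta> x"
    and v_ge2: "AE x in lebesgue_on \<Omega>. A x \<bullet> Dv x \<ge> \<eta> x"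
  shows "integrable (lebesgue_on \<Omega>) (\<lambda>x. A x \<bullet> Dv x)"
    "integrable (lebesgue_on \<Omega>) (\<lambda>x. B x * v x)"
    "(LINT x|lebesgue_on \<Omega>. A x \<bullet> Dv x) + (LINT x|lebesgue_on \<Omega>. B x * v x) = w v"
proof -
  let ?M = "lebesgue_on \<Omega>"
  note usq = H01_sq_integrable[OF uH] and vsq = H01_sq_integrable[OF vH]
  have [measurable]: "u \<in> borel_measurable ?M" "Du \<in> borel_measurable ?M"
      "v \<in> borel_measurable ?M" "Dv \<in> borel_measurable ?M"
    using usq vsq by (auto simp: sq_integrable_def)
  define N where "N n = real (Suc n)" for n
  have N: "N n > 0" "N n \<ge> 1" for n by (auto simp: N_def)
  \<comment> \<open>\<open>d n\<close> is the test function; in its gradient \<open>c n\<close> is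
    the coefficient of \<open>Dv\<close> and \<open>e n\<close> that of \<open>Du\<close>.\<close>
  define c where "c n x = cutoff (N n) (u x) * trunc' (N n) (v x)" for n x
  define d where "d n x = cutoff (N n) (u x) * trunc (N n) (v x)" for n x
  define e where "e n x = cutoff' (N n) (u x) * trunc (N n) (v x)" for n x
  have [measurable]: "(\<lambda>x. cutoff (N n) (u x)) \<in> borel_measurable ?M" for n
    by (rule borel_measurable_compose_deriv[OF has_real_derivative_cutoff[OF N(1)]]) measurable
  have [measurable]: "(\<lambda>x. trunc (N n) (v x)) \<in> borel_measurable ?M" for n
    by (rule borel_measurable_compose_deriv[OF has_real_derivative_trunc[OF N(1)]]) measurable
  have [measurable]: "cutoff' (N n) \<in> borel_measurable borel" "trunc' (N n) \<in> borel_measurable borel" for n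
    by (intro borel_measurable_continuous_onI continuous_on_cutoff' continuous_on_trunc')+
  have [measurable]: "c n \<in> borel_measurable ?M" "d n \<in> borel_measurable ?M" "e n \<in> borel_measurable ?M" for n
    unfolding c_def d_def e_def by measurable
  have c01: "0 \<le> c n x" "c n x \<le> 1" for n x
    using cutoff_range trunc'_range by (auto simp: c_def intro!: mult_nonneg_nonneg mult_le_one)
  have d_v: "0 \<le> d n x * v x" "\<bar>d n x\<bar> \<le> \<bar>v x\<bar>" for n x
  proof -
    show "0 \<le> d n x * v x"
      using mult_nonneg_nonneg[OF cutoff_range(1) trunc_mult_nonneg[OF N(1)], of "N n" "u x" n "v x"]
      by (simp add: d_def mult.assoc)
    have "\<bar>d n x\<bar> \<le> 1 * \<bar>v x\<bar>"
      unfolding d_def abs_mult using cutoff_range abs_trunc_le[OF N(1)]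
      by (intro mult_mono) auto
    then show "\<bar>d n x\<bar> \<le> \<bar>v x\<bar>" by simp
  qed
  have d_le: "\<bar>d n x\<bar> \<le> 2 * N n" for n x
  proof -
    have "\<bar>d n x\<bar> \<le> 1 * (2 * N n)"
      unfolding d_def abs_mult using cutoff_range abs_trunc_le_const[OF N(1)]
      by (intro mult_mono) auto
    then show ?thesis by simp
  qed
  have e_le: "\<bar>e n x\<bar> \<le> 8 / N n" for n x
  proof -
    have "\<bar>e n x\<bar> \<le> 4 / (N n)\<^sup>2 * (2 * N n)"
      unfolding e_def abs_mult using abs_cutoff'_le[OF N(1)] abs_trunc_le_const[OF N(1)]
      by (intro mult_mono) auto
    also have "\<dots> = 8 / N n" using N(1)[of n] by (simp add: power2_eq_square)
    finally show ?thesis .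
  qed
  have e_le8: "\<bar>e n x\<bar> \<le> 8" for n x
  proof -
    have "8 / N n \<le> 8" using N[of n] by (simp add: field_simps)
    then show ?thesis using e_le[of n x] by linarith
  qed
  have c_lim: "(\<lambda>n. c n x) \<longlonglongrightarrow> 1" for x
    using tendsto_mult[OF tendsto_cutoff tendsto_trunc'] by (simp add: c_def N_def)
  have d_lim: "(\<lambda>n. d n x) \<longlonglongrightarrow> v x" for x
    using tendsto_mult[OF tendsto_cutoff tendsto_trunc] by (simp add: d_def N_def)
  have e_lim: "(\<lambda>n. e n x) \<longlonglongrightarrow> 0" for x
  proof (rule Lim_null_comparison)
    show "\<forall>\<^sub>F n in sequentially. norm (e n x) \<le> 8 * (1 / real (Suc n))"
      using e_le by (intro always_eventually) (simp add: N_def)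
    have "(\<lambda>n. 8 * (1 / real (Suc n))) \<longlonglongrightarrow> 8 * 0"
      by (intro tendsto_intros LIMSEQ_Suc[OF lim_1_over_n])
    then show "(\<lambda>n. 8 * (1 / real (Suc n))) \<longlonglongrightarrow> 0" by simp
  qed
  have supp: "\<bar>u x\<bar> \<le> (N n)\<^sup>2" if "cutoff (N n) (u x) \<noteq> 0" for n x
    using cutoff_eq_0[OF N(1)] that by (metis not_le)

  define Dz where "Dz n x = c n x *\<^sub>R Dv x + e n x *\<^sub>R Du x" for n x
  have z: "H01 \<Omega> (d n) (Dz n)" for n
    unfolding d_def[abs_def] Dz_def[abs_def] c_def e_def
  proof (rule H01_mult_compose[OF \<Omega> uH vH])
    \<comment> \<open>One constant above the four bounds 1, \<open>4 / (N n)\<^sup>2\<close>,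
      \<open>2 * N n\<close> and 1.\<close>
    let ?K = "2 * N n + 4"
    show "\<bar>cutoff (N n) s\<bar> \<le> ?K" for s
      using cutoff_range[of "N n" s] N(1)[of n] by linarith
    have "4 / (N n)\<^sup>2 \<le> 4" using one_le_power[OF N(2)[of n], of 2] by (simp add: divide_le_eq N(1)[THEN less_imp_neq, symmetric])
    then show "\<bar>cutoff' (N n) s\<bar> \<le> ?K" for s
      using abs_cutoff'_le[OF N(1), of n s] N(1)[of n] by linarith
    show "\<bar>trunc (N n) s\<bar> \<le> ?K" for s
      using abs_trunc_le_const[OF N(1), of n s] by linarith
    show "\<bar>trunc' (N n) s\<bar> \<le> ?K" for s
      using trunc'_range[of "N n" s] N(1)[of n] by linarith
  qed (auto simp: trunc_def intro!: has_real_derivative_cutoff continuous_on_cutoff'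
      has_real_derivative_trunc[unfolded trunc_def[abs_def]] continuous_on_trunc' N)
  \<comment> \<open>Where \<open>d n\<close> is nonzero the cutoff is nonzero, hence
    \<open>\<bar>u x\<bar> \<le> (N n)\<^sup>2\<close>; this is the boundedness of \<open>u\<close>
    that \<open>in_Vu\<close> demands.\<close>
  have Vu: "in_Vu \<Omega> u (d n) (Dz n)" for n
    unfolding in_Vu_def ess_bdd_on_def
  proof (intro conjI z exI AE_I2)
    show "\<bar>d n x\<bar> \<le> 2 * N n" for x by (rule d_le)
    show "\<bar>u x\<bar> \<le> (N n)\<^sup>2" if "x \<in> space (lebesgue_on {x \<in> \<Omega>. d n x \<noteq> 0})" for x
      using that by (intro supp) (auto simp: d_def)
  qed
  have wlim: "(\<lambda>n. w (d n)) \<longlonglongrightarrow> w v"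
  proof (rule Hminus1_tendsto[OF \<Omega> w vH z])
    have "L2_lim ?M (\<lambda>n x. c n x *\<^sub>R Dv x + e n x *\<^sub>R Du x) (\<lambda>x. 1 *\<^sub>R Dv x + 0 *\<^sub>R Du x)"
    proof (rule L2_lim_add)
      show "L2_lim ?M (\<lambda>n x. c n x *\<^sub>R Dv x) (\<lambda>x. 1 *\<^sub>R Dv x)"
        by (rule L2_lim_scaleR[OF L2_lim_const[OF vsq(2)], where K=1])
           (use c01 c_lim in \<open>auto simp: abs_le_iff intro: order_trans[of _ 0]\<close>)
      show "L2_lim ?M (\<lambda>n x. e n x *\<^sub>R Du x) (\<lambda>x. 0 *\<^sub>R Du x)"
        by (rule L2_lim_scaleR[OF L2_lim_const[OF usq(2)], where K=8])
           (use e_le8 e_lim in auto)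
    qed
    then show "L2_lim ?M Dz Dv" by (simp add: Dz_def[abs_def])
  qed

  \<comment> \<open>Tested with \<open>d n\<close>, the equation splits into a gradient term in
    \<open>v\<close>, a zero-order term, and an error from the derivative of the cutoff.\<close>
  define F where "F n x = c n x * (A x \<bullet> Dv x)" for n x
  define G where "G n x = B x * d n x" for n x
  define E where "E n x = e n x * (A x \<bullet> Du x)" for n x
  \<comment> \<open>On the support of the cutoff, monotonicity replaces
    \<open>a \<bar>u x\<bar>\<close> by a constant depending on \<open>n\<close>; elsewhere the term
    is 0. The same argument with \<open>b\<close> treats \<open>G n\<close>.\<close>
  have F: "integrable ?M (F n)" for n
  proof (rule Bochner_Integration.integrable_bound)
    show "integrable ?M (\<lambda>x. a ((N n)\<^sup>2) * (norm (Du x) * norm (Dv x)))"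
      using integrable_mult_norm[OF usq(2) vsq(2)] by simp
    show "F n \<in> borel_measurable ?M" unfolding F_def by measurable
    have "norm (F n x) \<le> norm (a ((N n)\<^sup>2) * (norm (Du x) * norm (Dv x)))" if x: "x \<in> \<Omega>" for x
    proof (cases "cutoff (N n) (u x) = 0")
      case False
      have "norm (F n x) \<le> 1 * (norm (A x) * norm (Dv x))"
        unfolding F_def norm_mult using c01[of n x] Cauchy_Schwarz_ineq2
        by (intro mult_mono) auto
      also have "\<dots> \<le> (a \<bar>u x\<bar> * norm (Du x)) * norm (Dv x)"
        using A_le[OF x] by (simp add: mult_right_mono)
      also have "\<dots> \<le> (a ((N n)\<^sup>2) * norm (Du x)) * norm (Dv x)"
        using supp[OF False] by (intro mult_right_mono mono_onD[OF a(1)]) auto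
      finally show ?thesis using a(2)[of "(N n)\<^sup>2"] by (simp add: mult.assoc)
    qed (simp add: F_def c_def)
    then show "AE x in ?M. norm (F n x) \<le> norm (a ((N n)\<^sup>2) * (norm (Du x) * norm (Dv x)))"
      by (intro AE_I2) auto
  qed
  have G: "integrable ?M (G n)" for n
  proof (rule Bochner_Integration.integrable_bound)
    show "integrable ?M (\<lambda>x. b ((N n)\<^sup>2) * (norm (Du x))\<^sup>2 * (2 * N n))"
      using usq(2) by (simp add: sq_integrable_def)
    show "G n \<in> borel_measurable ?M" unfolding G_def by measurable
    have "norm (G n x) \<le> norm (b ((N n)\<^sup>2) * (norm (Du x))\<^sup>2 * (2 * N n))" if x: "x \<in> \<Omega>" for x
    proof (cases "cutoff (N n) (u x) = 0")
      case False
      have "\<bar>B x\<bar> \<le> b \<bar>u x\<bar> * (norm (Du x))\<^sup>2" by (rule B_le[OF x])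
      also have "\<dots> \<le> b ((N n)\<^sup>2) * (norm (Du x))\<^sup>2"
        using supp[OF False] by (intro mult_right_mono mono_onD[OF b(1)]) auto
      finally have "norm (G n x) \<le> b ((N n)\<^sup>2) * (norm (Du x))\<^sup>2 * (2 * N n)"
        unfolding G_def norm_mult using d_le b(2)[of "(N n)\<^sup>2"] by (intro mult_mono) auto
      then show ?thesis by simp
    qed (simp add: G_def d_def)
    then show "AE x in ?M. norm (G n x) \<le> norm (b ((N n)\<^sup>2) * (norm (Du x))\<^sup>2 * (2 * N n))"
      by (intro AE_I2) auto
  qed
  \<comment> \<open>Integrability of \<open>A x \<bullet> Du x\<close> enters here: it dominates the
    errors, whose coefficients are bounded by 8 and tend to 0.\<close>
  have int8: "integrable ?M (\<lambda>x. 8 * \<bar>A x \<bullet> Du x\<bar>)"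
    using u_int by auto
  have E_meas: "E n \<in> borel_measurable ?M" for n unfolding E_def by measurable
  have E_le: "AE x in ?M. norm (E n x) \<le> 8 * \<bar>A x \<bullet> Du x\<bar>" for n
    using e_le8 by (intro AE_I2) (simp add: E_def abs_mult mult_right_mono)
  have E_lim: "AE x in ?M. (\<lambda>n. E n x) \<longlonglongrightarrow> 0"
    unfolding E_def using e_lim by (intro AE_I2 tendsto_mult_left_zero)
  have E: "integrable ?M (E n)" for n
    by (rule integrable_dominated_convergence2[OF _ E_meas int8 E_lim E_le]) simp
  have E0: "(\<lambda>n. LINT x|?M. E n x) \<longlonglongrightarrow> 0"
    using integral_dominated_convergence[OF _ E_meas int8 E_lim E_le] by simp
  have "(LINT x|?M. F n x) + (LINT x|?M. G n x) = w (d n) - (LINT x|?M. E n x)" for n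
  proof -
    have "(LINT x|?M. A x \<bullet> Dz n x) = (LINT x|?M. F n x + E n x)"
      by (simp add: Dz_def F_def E_def inner_add_right)
    also have "\<dots> = (LINT x|?M. F n x) + (LINT x|?M. E n x)"
      by (rule Bochner_Integration.integral_add[OF F E])
    finally show ?thesis using u_eq[OF Vu[of n]] by (simp add: G_def)
  qed
  then have L: "(\<lambda>n. (LINT x|?M. F n x) + (LINT x|?M. G n x)) \<longlonglongrightarrow> w v"
    using tendsto_diff[OF wlim E0] by simp
  have \<eta>': "integrable ?M (\<lambda>x. \<bar>\<eta> x\<bar>)" using \<eta> by auto
  have F_lim: "AE x in ?M. (\<lambda>n. F n x) \<longlonglongrightarrow> A x \<bullet> Dv x"
    using tendsto_mult_right[OF c_lim] by (intro AE_I2) (simp add: F_def)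
  have G_lim: "AE x in ?M. (\<lambda>n. G n x) \<longlonglongrightarrow> B x * v x"
    unfolding G_def by (intro AE_I2 tendsto_mult_left d_lim)
  have F_ge: "AE x in ?M. - \<bar>\<eta> x\<bar> \<le> F n x" for n
    using v_ge2 unfolding F_def
    by eventually_elim (rule mult_ge_of_unit_interval(1)[OF _ c01])
  have G_ge: "AE x in ?M. - \<bar>\<eta> x\<bar> \<le> G n x" for n
    using v_ge1 unfolding G_def
    by eventually_elim (rule mult_ge_of_contraction(1)[OF _ d_v])
  have F_le: "AE x in ?M. \<bar>F n x\<bar> \<le> \<bar>A x \<bullet> Dv x\<bar>" for n
    unfolding F_def using mult_ge_of_unit_interval(2)[OF order_refl c01] by auto
  have G_le: "AE x in ?M. \<bar>G n x\<bar> \<le> \<bar>B x * v x\<bar>" for n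
    unfolding G_def using mult_ge_of_contraction(2)[OF order_refl d_v] by auto
  have m1: "(\<lambda>x. A x \<bullet> Dv x) \<in> borel_measurable ?M" by measurable
  have m2: "(\<lambda>x. B x * v x) \<in> borel_measurable ?M" by measurable
  note fin = integral_sum_limit_dominated_by_limit[OF F G m1 m2 \<eta>' F_lim G_lim F_ge G_ge F_le G_le L]
  show "integrable ?M (\<lambda>x. A x \<bullet> Dv x)" "integrable ?M (\<lambda>x. B x * v x)"
    "(LINT x|?M. A x \<bullet> Dv x) + (LINT x|?M. B x * v x) = w v"
    by (rule fin)+
qed

subsection \<open>Structural estimates and the theorem\<close>

lemma strict_convex_on_imp_convex_on:
  assumes "strict_convex_on S f" "convex S"
  shows "convex_on S f"
proof (rule convex_onI[OF _ assms(2)])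
  fix t :: real and x y assume *: "0 < t" "t < 1" "x \<in> S" "y \<in> S"
  show "f ((1 - t) *\<^sub>R x + t *\<^sub>R y) \<le> (1 - t) * f x + t * f y"
  proof (cases "x = y")
    case True
    then show ?thesis by (simp add: algebra_simps flip: scaleR_add_left)
  next
    case False
    then show ?thesis using assms(1) * unfolding strict_convex_on_def by (meson less_imp_le)
  qed
qed

text \<open>Along the line \<open>x + t *\<^sub>R h\<close> this is the tangent inequality for a
  convex function of one variable.\<close>

lemma convex_on_above_gradient:
  fixes f :: "'a::real_inner \<Rightarrow> real"
  assumes f: "convex_on UNIV f" and g: "(f has_derivative (\<lambda>h. g \<bullet> h)) (at x)"
  shows "g \<bullet> h \<le> f (x + h) - f x"
proof -
  define F where "F t = f (x + t *\<^sub>R h)" for t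
  have F: "convex_on UNIV F"
  proof (rule convex_onI)
    fix t r s :: real assume t: "0 < t" "t < 1"
    have "x + ((1 - t) *\<^sub>R r + t *\<^sub>R s) *\<^sub>R h = (1 - t) *\<^sub>R (x + r *\<^sub>R h) + t *\<^sub>R (x + s *\<^sub>R h)"
      by (simp add: algebra_simps)
    then show "F ((1 - t) *\<^sub>R r + t *\<^sub>R s) \<le> (1 - t) * F r + t * F s"
      unfolding F_def using convex_onD[OF f, of t "x + r *\<^sub>R h" "x + s *\<^sub>R h"] t by simp
  qed simp
  have "((\<lambda>t. x + t *\<^sub>R h) has_derivative (\<lambda>t. t *\<^sub>R h)) (at 0)"
    by (auto intro!: derivative_eq_intros)
  then have "(F has_derivative (\<lambda>t. g \<bullet> (t *\<^sub>R h))) (at 0)"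
    unfolding F_def by (rule has_derivative_compose) (simp add: g)
  then have "(F has_field_derivative g \<bullet> h) (at 0)"
    by (simp add: has_field_derivative_def mult.commute[of _ "g \<bullet> h"])
  from convex_on_imp_above_tangent[OF F _ _ _ this, of 1] show ?thesis
    by (simp add: F_def)
qed

text \<open>The gradient inequality is used with an increment along \<open>g\<close> itself, so that
  its left side is a multiple of \<open>(norm g)\<^sup>2\<close> and its right side is controlled by
  the quadratic growth.\<close>

lemma convex_quadratic_growth_gradient_bound:
  fixes f :: "'a::real_inner \<Rightarrow> real"
  assumes f: "convex_on UNIV f" and g: "(f has_derivative (\<lambda>h. g \<bullet> h)) (at x)"
    and f0: "\<And>y. 0 \<le> f y" and fle: "\<And>y. f y \<le> c * (norm y)\<^sup>2" and c: "c > 0"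
  shows "norm g \<le> 4 * c * norm x"
proof -
  \<comment> \<open>This step length makes the quadratic term on the right,
    \<open>2 * c * t\<^sup>2 * (norm g)\<^sup>2\<close>, half of the left side, so it can be
    absorbed.\<close>
  define t where "t = 1 / (4 * c)"
  have "g \<bullet> (t *\<^sub>R g) \<le> f (x + t *\<^sub>R g) - f x"
    by (rule convex_on_above_gradient[OF f g])
  also have "\<dots> \<le> c * (norm (x + t *\<^sub>R g))\<^sup>2"
    using f0[of x] fle[of "x + t *\<^sub>R g"] by linarith
  also have "\<dots> \<le> c * (2 * (norm x)\<^sup>2 + 2 * (norm (t *\<^sub>R g))\<^sup>2)"
    using c by (intro mult_left_mono norm_add_sq_le) auto
  finally have "t * (norm g)\<^sup>2 \<le> 2 * c * (norm x)\<^sup>2 + 2 * c * t\<^sup>2 * (norm g)\<^sup>2"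
    by (simp add: dot_square_norm power_mult_distrib algebra_simps)
  moreover have "2 * c * t\<^sup>2 = t / 2"
    using c by (simp add: t_def power2_eq_square)
  ultimately have "t * (norm g)\<^sup>2 \<le> 4 * c * (norm x)\<^sup>2" by simp
  then have "(norm g)\<^sup>2 \<le> (4 * c * norm x)\<^sup>2"
    using c by (simp add: t_def field_simps power2_eq_square)
  then show ?thesis
    using c by (intro power2_le_imp_le[of "norm g"]) auto
qed

text \<open>The derivative is a limit of measurable difference quotients. This transfers
  measurability in \<open>x\<close> from \<open>j\<close> to its partial derivatives.\<close>

lemma borel_measurable_directional_derivative:
  fixes f :: "'a \<Rightarrow> 'b::real_normed_vector \<Rightarrow> real"
  assumes f[measurable]: "\<And>y. (\<lambda>x. f x y) \<in> borel_measurable M"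
    and f': "\<And>x. x \<in> space M \<Longrightarrow> (f x has_derivative f' x) (at y)"
  shows "(\<lambda>x. f' x h) \<in> borel_measurable M"
proof (rule borel_measurable_LIMSEQ_real)
  let ?t = "\<lambda>n. 1 / real (Suc n)"
  show "(\<lambda>x. (f x (y + ?t n *\<^sub>R h) - f x y) / ?t n) \<in> borel_measurable M" for n
    by measurable
  fix x assume x: "x \<in> space M"
  have lin: "linear (f' x)" using f'[OF x] has_derivative_linear by blast
  have "((\<lambda>t::real. y + t *\<^sub>R h) has_derivative (\<lambda>t. t *\<^sub>R h)) (at 0)"
    by (auto intro!: derivative_eq_intros)
  then have "((\<lambda>t. f x (y + t *\<^sub>R h)) has_derivative (\<lambda>t. f' x (t *\<^sub>R h))) (at 0)"
    by (rule has_derivative_compose) (simp add: f'[OF x])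
  then have "((\<lambda>t. f x (y + t *\<^sub>R h)) has_field_derivative f' x h) (at 0)"
    by (simp add: has_field_derivative_def linear_scale[OF lin] mult.commute[of _ "f' x h"])
  then have "((\<lambda>t. (f x (y + t *\<^sub>R h) - f x y) / t) \<longlongrightarrow> f' x h) (at 0)"
    by (simp add: DERIV_def)
  moreover have "filterlim ?t (at 0) sequentially"
    using LIMSEQ_Suc[OF lim_1_over_n] by (auto simp: filterlim_at)
  ultimately show "(\<lambda>n. (f x (y + ?t n *\<^sub>R h) - f x y) / ?t n) \<longlonglongrightarrow> f' x h"
    by (rule filterlim_compose)
qed

section \<open>Structural bounds for the integrand and conclusions for \<open>v\<close>, for
  \<open>u\<close> and for all of W_u\<close>

theorem theorem4p8:
  fixes \<Omega> :: "'a::euclidean_space set"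
    and j :: "'a \<Rightarrow> real \<Rightarrow> 'a \<Rightarrow> real"
    and js :: "'a \<Rightarrow> real \<Rightarrow> 'a \<Rightarrow> real"
    and jxi :: "'a \<Rightarrow> real \<Rightarrow> 'a \<Rightarrow> 'a"
    and \<alpha> \<beta> :: "real \<Rightarrow> real" and \<alpha>0 :: real
    and w :: "('a \<Rightarrow> real) \<Rightarrow> real"
    and u v \<eta> :: "'a \<Rightarrow> real" and Du Dv :: "'a \<Rightarrow> 'a"
  assumes dim: "DIM('a) \<ge> 3"
    and \<Omega>: "open \<Omega>" "bounded \<Omega>"
    and j_meas: "\<And>s \<xi>. (\<lambda>x. j x s \<xi>) \<in> borel_measurable (lebesgue_on \<Omega>)"
    and j_deriv: "\<And>x s \<xi>. x \<in> \<Omega> \<Longrightarrow>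
        ((\<lambda>(t, \<zeta>). j x t \<zeta>) has_derivative (\<lambda>(h, k). js x s \<xi> * h + jxi x s \<xi> \<bullet> k)) (at (s, \<xi>))"
    and js_cont: "\<And>x. x \<in> \<Omega> \<Longrightarrow> continuous_on UNIV (\<lambda>(t, \<zeta>). js x t \<zeta>)"
    and jxi_cont: "\<And>x. x \<in> \<Omega> \<Longrightarrow> continuous_on UNIV (\<lambda>(t, \<zeta>). jxi x t \<zeta>)"
    and H1: "\<And>x s. x \<in> \<Omega> \<Longrightarrow> strict_convex_on UNIV (j x s)"
    and \<alpha>0_pos: "\<alpha>0 > 0"
    and \<alpha>_pos: "\<And>t. t \<ge> 0 \<Longrightarrow> \<alpha> t > 0"
    and \<alpha>_mono: "mono_on {0..} \<alpha>" and \<alpha>_cont: "continuous_on {0..} \<alpha>"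
    and H2: "\<And>x s \<xi>. x \<in> \<Omega> \<Longrightarrow>
        \<alpha>0 * (norm \<xi>)\<^sup>2 \<le> j x s \<xi> \<and> j x s \<xi> \<le> \<alpha> \<bar>s\<bar> * (norm \<xi>)\<^sup>2"
    and \<beta>_pos: "\<And>t. t \<ge> 0 \<Longrightarrow> \<beta> t > 0"
    and \<beta>_mono: "mono_on {0..} \<beta>" and \<beta>_cont: "continuous_on {0..} \<beta>"
    and H3: "\<And>x s \<xi>. x \<in> \<Omega> \<Longrightarrow> \<bar>js x s \<xi>\<bar> \<le> \<beta> \<bar>s\<bar> * (norm \<xi>)\<^sup>2"
    and H4: "\<exists>R>0. \<forall>x\<in>\<Omega>. \<forall>s \<xi>. \<bar>s\<bar> \<ge> R \<longrightarrow> js x s \<xi> * s \<ge> 0"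
    and w: "Hminus1 \<Omega> w"
    and u: "H01 \<Omega> u Du"
    and u_eq: "\<And>z Dz. in_Vu \<Omega> u z Dz \<Longrightarrow>
        (LINT x|lebesgue_on \<Omega>. jxi x (u x) (Du x) \<bullet> Dz x)
      + (LINT x|lebesgue_on \<Omega>. js x (u x) (Du x) * z x) = w z"
    and u_int: "integrable (lebesgue_on \<Omega>) (\<lambda>x. jxi x (u x) (Du x) \<bullet> Du x)"
    and v: "H01 \<Omega> v Dv"
    and \<eta>: "integrable (lebesgue_on \<Omega>) \<eta>"
    and v_ge1: "AE x in lebesgue_on \<Omega>. js x (u x) (Du x) * v x \<ge> \<eta> x"
    and v_ge2: "AE x in lebesgue_on \<Omega>. jxi x (u x) (Du x) \<bullet> Dv x \<ge> \<eta> x"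
  shows "integrable (lebesgue_on \<Omega>) (\<lambda>x. js x (u x) (Du x) * v x)
    \<and> integrable (lebesgue_on \<Omega>) (\<lambda>x. jxi x (u x) (Du x) \<bullet> Dv x)
    \<and> (LINT x|lebesgue_on \<Omega>. jxi x (u x) (Du x) \<bullet> Dv x)
      + (LINT x|lebesgue_on \<Omega>. js x (u x) (Du x) * v x) = w v
    \<and> integrable (lebesgue_on \<Omega>) (\<lambda>x. js x (u x) (Du x) * u x)
    \<and> integrable (lebesgue_on \<Omega>) (\<lambda>x. js x (u x) (Du x))
    \<and> (LINT x|lebesgue_on \<Omega>. jxi x (u x) (Du x) \<bullet> Du x)
      + (LINT x|lebesgue_on \<Omega>. js x (u x) (Du x) * u x) = w u
    \<and> gen_solution \<Omega> js jxi w u Du"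
proof -
  let ?M = "lebesgue_on \<Omega>"
  define A where "A x = jxi x (u x) (Du x)" for x
  define B where "B x = js x (u x) (Du x)" for x
  note usq = H01_sq_integrable[OF u]
  have uDu: "(\<lambda>x. (u x, Du x)) \<in> borel_measurable ?M"
    using usq by (auto simp: sq_integrable_def)
  \<comment> \<open>Directions in the product space yield both partial derivatives:
    \<open>(1, 0)\<close> isolates \<open>js\<close>, and \<open>(0, k)\<close> gives the components
    of \<open>jxi\<close>.\<close>
  have dir: "(\<lambda>x. js x s \<xi> * h + jxi x s \<xi> \<bullet> k) \<in> borel_measurable ?M" for s \<xi> h k
  proof -
    have "(\<lambda>x. (\<lambda>(h, k). js x s \<xi> * h + jxi x s \<xi> \<bullet> k) (h, k)) \<in> borel_measurable ?M"
      by (rule borel_measurable_directional_derivative[where f="\<lambda>x (t, \<zeta>). j x t \<zeta>" and y="(s, \<xi>)"])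
         (use j_meas j_deriv in \<open>auto simp: case_prod_unfold\<close>)
    then show ?thesis by simp
  qed
  have "(\<lambda>x. js x s \<xi>) \<in> borel_measurable ?M" for s \<xi>
    using dir[of s \<xi> 1 0] by simp
  then have B_meas: "B \<in> borel_measurable ?M"
    using borel_measurable_Caratheodory[of "\<lambda>x (t, \<zeta>). js x t \<zeta>", OF _ _ uDu] js_cont
    by (auto simp: B_def[abs_def] case_prod_unfold)
  have "(\<lambda>x. jxi x s \<xi>) \<in> borel_measurable ?M" for s \<xi>
    using dir[of s \<xi> 0] by (subst borel_measurable_euclidean_space) simp
  then have A_meas: "A \<in> borel_measurable ?M"
    using borel_measurable_Caratheodory[of "\<lambda>x (t, \<zeta>). jxi x t \<zeta>", OF _ _ uDu] jxi_cont
    by (auto simp: A_def[abs_def] case_prod_unfold)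
  have jxi: "(j x s has_derivative (\<lambda>k. jxi x s \<xi> \<bullet> k)) (at \<xi>)" if "x \<in> \<Omega>" for x s \<xi>
  proof -
    have "((\<lambda>\<zeta>. (s, \<zeta>)) has_derivative (\<lambda>k. (0, k))) (at \<xi>)"
      by (auto intro!: derivative_eq_intros)
    from has_derivative_compose[OF this j_deriv[OF that]] show ?thesis by simp
  qed
  have conv: "convex_on UNIV (j x s)" if "x \<in> \<Omega>" for x s
    using strict_convex_on_imp_convex_on[OF H1[OF that]] by simp
  have j0: "0 \<le> j x s \<xi>" if "x \<in> \<Omega>" for x s \<xi>
    using H2[OF that, of \<xi> s] \<alpha>0_pos by (meson less_imp_le mult_nonneg_nonneg order_trans zero_le_power2)
  \<comment> \<open>Convexity from (H1) and the quadratic growth in (H2) give linear growth of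
    \<open>jxi\<close> in the gradient.\<close>
  have A_le: "norm (A x) \<le> 4 * \<alpha> \<bar>u x\<bar> * norm (Du x)" if "x \<in> \<Omega>" for x
    unfolding A_def using H2[OF that] \<alpha>_pos
    by (intro convex_quadratic_growth_gradient_bound[OF conv[OF that] jxi[OF that] j0[OF that]]) auto
  have B_le: "\<bar>B x\<bar> \<le> \<beta> \<bar>u x\<bar> * (norm (Du x))\<^sup>2" if "x \<in> \<Omega>" for x
    unfolding B_def by (rule H3[OF that])
  \<comment> \<open>The increment \<open>- Du x\<close> leads to \<open>\<xi> = 0\<close>, where
    (H2) forces \<open>j\<close> to vanish.\<close>
  have A_Du: "0 \<le> A x \<bullet> Du x" if "x \<in> \<Omega>" for x
  proof -
    have "A x \<bullet> (- Du x) \<le> j x (u x) (Du x + - Du x) - j x (u x) (Du x)"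
      unfolding A_def by (rule convex_on_above_gradient[OF conv[OF that] jxi[OF that]])
    then show ?thesis using H2[OF that, of 0 "u x"] j0[OF that, of "u x" "Du x"] by simp
  qed
  have \<alpha>4: "mono_on {0..} (\<lambda>t. 4 * \<alpha> t)"
    using \<alpha>_mono by (auto simp: mono_on_def)
  \<comment> \<open>Stated for a general \<open>z\<close> and lower bound \<open>\<theta>\<close>,
    since it is applied to \<open>v\<close>, to \<open>u\<close> and to every member of W_u.\<close>
  have core: "integrable ?M (\<lambda>x. A x \<bullet> Dz x)" "integrable ?M (\<lambda>x. B x * z x)"
      "(LINT x|?M. A x \<bullet> Dz x) + (LINT x|?M. B x * z x) = w z"
    if "H01 \<Omega> z Dz" "integrable ?M \<theta>" "AE x in ?M. B x * z x \<ge> \<theta> x" "AE x in ?M. A x \<bullet> Dz x \<ge> \<theta> x"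
    for z Dz \<theta>
    by (rule weak_equation_extends[OF \<Omega> u A_meas B_meas \<alpha>4 _ \<beta>_mono _ A_le B_le w _ _ that];
        use \<alpha>_pos \<beta>_pos u_eq u_int in \<open>force simp: A_def B_def intro: less_imp_le\<close>)+

  obtain R where R: "R > 0" "\<And>x s \<xi>. x \<in> \<Omega> \<Longrightarrow> \<bar>s\<bar> \<ge> R \<Longrightarrow> js x s \<xi> * s \<ge> 0"
    using H4 by blast
  have \<beta>_le: "\<bar>B x\<bar> \<le> \<beta> R * (norm (Du x))\<^sup>2" if "x \<in> \<Omega>" "\<bar>u x\<bar> \<le> R" for x
  proof -
    have "\<beta> \<bar>u x\<bar> * (norm (Du x))\<^sup>2 \<le> \<beta> R * (norm (Du x))\<^sup>2"
      using that(2) R(1) by (intro mult_right_mono mono_onD[OF \<beta>_mono]) auto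
    then show ?thesis using B_le[OF that(1)] by linarith
  qed
  \<comment> \<open>By (H4) the product \<open>B x * u x\<close> can be negative only where
    \<open>\<bar>u x\<bar> < R\<close>; there (H3) and monotonicity of \<open>\<beta>\<close> bound
    its modulus by \<open>- \<theta> x\<close>.\<close>
  define \<theta> where "\<theta> x = - (\<beta> R * R * (norm (Du x))\<^sup>2)" for x
  have \<theta>_int: "integrable ?M \<theta>"
    using usq(2) by (simp add: \<theta>_def[abs_def] sq_integrable_def)
  have \<theta>_le: "\<theta> x \<le> 0" for x
    using \<beta>_pos[of R] R(1) by (simp add: \<theta>_def)
  have Bu_ge: "\<theta> x \<le> B x * u x" if x: "x \<in> \<Omega>" for x
  proof (cases "\<bar>u x\<bar> \<ge> R")
    case True
    then show ?thesis using R(2)[OF x True, of "Du x"] \<theta>_le[of x] by (simp add: B_def)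
  next
    case False
    have "\<bar>B x * u x\<bar> \<le> (\<beta> R * (norm (Du x))\<^sup>2) * R"
      unfolding abs_mult using False \<beta>_le[OF x] \<beta>_pos[of R] R(1) by (intro mult_mono) auto
    then show ?thesis by (simp add: \<theta>_def mult_ac)
  qed
  have u_core: "integrable ?M (\<lambda>x. A x \<bullet> Du x)" "integrable ?M (\<lambda>x. B x * u x)"
      "(LINT x|?M. A x \<bullet> Du x) + (LINT x|?M. B x * u x) = w u"
  proof -
    have 1: "AE x in ?M. B x * u x \<ge> \<theta> x"
      using Bu_ge by (intro AE_I2) auto
    have 2: "AE x in ?M. A x \<bullet> Du x \<ge> \<theta> x"
      using A_Du \<theta>_le by (intro AE_I2) (force intro: order_trans)
    show "integrable ?M (\<lambda>x. A x \<bullet> Du x)" "integrable ?M (\<lambda>x. B x * u x)"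
      "(LINT x|?M. A x \<bullet> Du x) + (LINT x|?M. B x * u x) = w u"
      by (rule core[OF u \<theta>_int 1 2])+
  qed
  have B_int: "integrable ?M B"
  proof (rule Bochner_Integration.integrable_bound[OF _ B_meas])
    show "integrable ?M (\<lambda>x. \<beta> R * (norm (Du x))\<^sup>2 + \<bar>B x * u x\<bar> / R)"
      using usq(2) u_core(2) by (auto simp: sq_integrable_def)
    \<comment> \<open>The first summand covers \<open>\<bar>u x\<bar> \<le> R\<close>; beyond
      \<open>R\<close>, dividing \<open>\<bar>B x * u x\<bar>\<close> by \<open>R\<close> leaves at
      least \<open>\<bar>B x\<bar>\<close>.\<close>
    have "\<bar>B x\<bar> \<le> \<beta> R * (norm (Du x))\<^sup>2 + \<bar>B x * u x\<bar> / R" if x: "x \<in> \<Omega>" for x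
    proof (cases "\<bar>u x\<bar> \<le> R")
      case True
      then show ?thesis using \<beta>_le[OF x True] R(1) by (simp add: add_increasing2)
    next
      case False
      then have "\<bar>B x\<bar> * R \<le> \<bar>B x\<bar> * \<bar>u x\<bar>" by (intro mult_left_mono) auto
      then have "\<bar>B x\<bar> \<le> \<bar>B x * u x\<bar> / R" using R(1) by (simp add: field_simps abs_mult)
      then show ?thesis using \<beta>_pos[of R] R(1) by (simp add: add_increasing)
    qed
    then show "AE x in ?M. norm (B x) \<le> norm (\<beta> R * (norm (Du x))\<^sup>2 + \<bar>B x * u x\<bar> / R)"
      by (intro AE_I2) (force intro: order_trans[OF _ abs_ge_self])
  qed
  have gen: "gen_solution \<Omega> js jxi w u Du"
    unfolding gen_solution_def A_def[symmetric] B_def[symmetric]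
  proof (intro conjI allI impI u u_core(1,2))
    fix z Dz assume "in_Wu \<Omega> js jxi u Du z Dz"
    then have z: "H01 \<Omega> z Dz" "integrable ?M (\<lambda>x. A x \<bullet> Dz x)" "integrable ?M (\<lambda>x. B x * z x)"
      by (auto simp: in_Wu_def A_def B_def)
    \<comment> \<open>For a member of W_u both integrands are integrable, so their minimum is an
      admissible lower bound.\<close>
    show "(LINT x|?M. A x \<bullet> Dz x) + (LINT x|?M. B x * z x) = w z"
      by (rule core(3)[OF z(1) integrable_min[OF z(2,3)]]) auto
  qed
  show ?thesis
    using core[OF v \<eta> v_ge1[folded B_def] v_ge2[folded A_def]] u_core B_int gen
    unfolding A_def B_def by blast
qed

end
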